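(* Let $F$ be an orthogonally invariant real-valued function on the set of real symmetric positive definite matrices of order $q$, and let $f:\mathbb{R}^q\to\mathbb{R}$ be the corresponding symmetric function, i.e. $F(\Sigma)=f(\log\lambda_1,\ldots,\log\lambda_q)$ where $\lambda_1\ge\cdots\ge\lambda_q>0$ are the eigenvalues of $\Sigma$. Then the following three conditions are equivalent: (i) $F(\Sigma)$ is g-convex; (ii) $F(\Sigma)$ is convex in $\log\Sigma$; (iii) $f$ is convex on $\mathbb{R}^q$. Likewise, the following three conditions are equivalent: (i') $F(\Sigma)$ is strictly g-convex; (ii') $F(\Sigma)$ is strictly convex in $\log\Sigma$; (iii') $f$ is strictly convex on $\mathbb{R}^q$.
   Context: $\Sigma>0$ means $\Sigma$ is a real symmetric positive definite matrix of order $q$. $F$ is orthogonally invariant if $F(\Sigma)=F(H\Sigma H^{\mathrm T})$ for every orthogonal matrix $H$ of order $q$ and every $\Sigma>0$. Such an $F$ can be written as $F(\Sigma)=f(\log\lambda_1,\ldots,\log\lambda_q)$ for a symmetric (i.e. invariant under permutations of its arguments) function $f:\mathbb{R}^q\to\mathbb{R}$; this $f$ is the function corresponding to $F$. The geodesic path from $\Sigma_0>0$ to $\Sigma_1>0$ is $\Sigma_t=\Sigma_0^{1/2}\{\Sigma_0^{-1/2}\Sigma_1\Sigma_0^{-1/2}\}^t\Sigma_0^{1/2}$, $0\le t\le 1$. $F$ is g-convex (geodesically convex) if $F(\Sigma_t)\le(1-t)F(\Sigma_0)+tF(\Sigma_1)$ for all $\Sigma_0,\Sigma_1>0$ and $0<t<1$,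 and strictly g-convex if strict inequality holds whenever $\Sigma_0\ne\Sigma_1$. $F$ is (strictly) convex in $\log\Sigma$ if $A\mapsto F(e^A)$ is (strictly) convex on the vector space of real symmetric matrices of order $q$, where $e^A$ is the matrix exponential. *)

theory Defs
  imports "HOL-Analysis.Analysis"
begin

definition sym_matrices :: "(real ^ 'q ^ 'q) set" where
  "sym_matrices = {A. transpose A = A}"

definition pos_def :: "real ^ 'q ^ 'q \<Rightarrow> bool" where
  "pos_def A \<longleftrightarrow> transpose A = A \<and> (\<forall>x. x \<noteq> 0 \<longrightarrow> 0 < x \<bullet> (A *v x))"

definition diag_matrix :: "real ^ 'q \<Rightarrow> real ^ 'q ^ 'q" where
  "diag_matrix d = (\<chi> i j. if i = j then d $ i else 0)"

(* The real power of a positive definite matrix: A\<^sup>t = H diag(d\<^sub>i\<^sup>t) H\<^sup>T for any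
   spectral decomposition A = H diag(d) H\<^sup>T with H orthogonal.  The value does not depend
   on the decomposition chosen; for matrices that are not positive definite the definition
   is not meant to be used. *)
definition mpow :: "real ^ 'q ^ 'q \<Rightarrow> real \<Rightarrow> real ^ 'q ^ 'q" where
  "mpow A t = (THE B. \<exists>H d. orthogonal_matrix H \<and>
      A = H ** diag_matrix d ** transpose H \<and>
      B = H ** diag_matrix (\<chi> i. d $ i powr t) ** transpose H)"

(* The type of square matrices carries no exp in the library (its multiplication * is
   entrywise), hence the exponential series for ** is written out. *)
definition matrix_exp :: "real ^ 'q ^ 'q \<Rightarrow> real ^ 'q ^ 'q" where
  "matrix_exp A = (\<Sum>n. (((\<lambda>B. A ** B) ^^ n) (mat 1)) /\<^sub>R fact n)"

(* l lists the eigenvalues of A in decreasing order and with multiplicity, i.e. as the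
   roots of the characteristic polynomial. *)
definition ordered_eigenvalues ::
    "real ^ 'q::{finite,linorder} ^ 'q::{finite,linorder} \<Rightarrow> real ^ 'q::{finite,linorder} \<Rightarrow> bool" where
  "ordered_eigenvalues A l \<longleftrightarrow>
     (\<forall>x. det (mat x - A) = (\<Prod>i\<in>UNIV. x - l $ i)) \<and> (\<forall>i j. i \<le> j \<longrightarrow> l $ j \<le> l $ i)"

definition orthogonally_invariant :: "(real ^ 'q ^ 'q \<Rightarrow> real) \<Rightarrow> bool" where
  "orthogonally_invariant F \<longleftrightarrow>
     (\<forall>H A. orthogonal_matrix H \<longrightarrow> pos_def A \<longrightarrow> F A = F (H ** A ** transpose H))"

definition symmetric_fun :: "(real ^ 'q \<Rightarrow> real) \<Rightarrow> bool" where
  "symmetric_fun f \<longleftrightarrow> (\<forall>p x. p permutes UNIV \<longrightarrow> f (\<chi> i. x $ p i) = f x)"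

definition corresponding_fun ::
    "(real ^ 'q::{finite,linorder} ^ 'q::{finite,linorder} \<Rightarrow> real) \<Rightarrow> (real ^ 'q::{finite,linorder} \<Rightarrow> real) \<Rightarrow> bool" where
  "corresponding_fun F f \<longleftrightarrow> symmetric_fun f \<and>
     (\<forall>A l. pos_def A \<longrightarrow> ordered_eigenvalues A l \<longrightarrow> F A = f (\<chi> i. ln (l $ i)))"

definition geodesic :: "real ^ 'q ^ 'q \<Rightarrow> real ^ 'q ^ 'q \<Rightarrow> real \<Rightarrow> real ^ 'q ^ 'q" where
  "geodesic A B t =
     mpow A (1/2) ** mpow (mpow A (- 1/2) ** B ** mpow A (- 1/2)) t ** mpow A (1/2)"

definition g_convex :: "(real ^ 'q ^ 'q \<Rightarrow> real) \<Rightarrow> bool" where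
  "g_convex F \<longleftrightarrow> (\<forall>A B t. pos_def A \<longrightarrow> pos_def B \<longrightarrow> 0 < t \<longrightarrow> t < 1 \<longrightarrow>
     F (geodesic A B t) \<le> (1 - t) * F A + t * F B)"

definition strictly_g_convex :: "(real ^ 'q ^ 'q \<Rightarrow> real) \<Rightarrow> bool" where
  "strictly_g_convex F \<longleftrightarrow>
     (\<forall>A B t. pos_def A \<longrightarrow> pos_def B \<longrightarrow> A \<noteq> B \<longrightarrow> 0 < t \<longrightarrow> t < 1 \<longrightarrow>
       F (geodesic A B t) < (1 - t) * F A + t * F B)"

(* Strict counterpart of the library's convex_on. *)
definition strictly_convex_on :: "'a::real_vector set \<Rightarrow> ('a \<Rightarrow> real) \<Rightarrow> bool" where
  "strictly_convex_on S f \<longleftrightarrow> convex S \<and>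
     (\<forall>x\<in>S. \<forall>y\<in>S. \<forall>u>0. \<forall>v>0. u + v = 1 \<longrightarrow> x \<noteq> y \<longrightarrow>
        f (u *\<^sub>R x + v *\<^sub>R y) < u * f x + v * f y)"

definition convex_in_log :: "(real ^ 'q ^ 'q \<Rightarrow> real) \<Rightarrow> bool" where
  "convex_in_log F \<longleftrightarrow> convex_on sym_matrices (\<lambda>A. F (matrix_exp A))"

definition strictly_convex_in_log :: "(real ^ 'q ^ 'q \<Rightarrow> real) \<Rightarrow> bool" where
  "strictly_convex_in_log F \<longleftrightarrow> strictly_convex_on sym_matrices (\<lambda>A. F (matrix_exp A))"

end

theory Submission
  imports Defs
begin

text \<open>
  Everything rests on majorization of eigenvalues. By the spectral theorem every symmetric matrix is
  \<open>H diag(a) H\<^sup>T\<close> with \<open>H\<close> orthogonal, and then \<open>F (H diag(exp a) H\<^sup>T) = f a\<close>. Restricted to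
  diagonal matrices, both the geodesic from \<open>diag(exp x)\<close> to \<open>diag(exp y)\<close> and the segment between
  the logarithms correspond to the segment from \<open>x\<close> to \<open>y\<close>, so each of the two convexity properties
  of \<open>F\<close> contains the corresponding one of \<open>f\<close>.

  Conversely, let \<open>a\<close> and \<open>b\<close> be the decreasing vectors of (logarithms of) eigenvalues of the end
  points and \<open>c\<close> that of the intermediate point. In both settings \<open>c\<close> is majorized by the same combination
  \<open>x\<close> of \<open>a\<close> and \<open>b\<close>, hence lies in the convex hull of the rearrangements of \<open>x\<close>
  (\<open>majorizes_imp_convex_hull\<close>), and a symmetric convex \<open>f\<close> gives \<open>f c \<le> f x\<close> and then the convexity
  bound. In the strict case something could be lost only if \<open>a = b\<close> and \<open>c\<close> is
  a rearrangement of \<open>a\<close>; but the squared Frobenius norm (for segments) and the trace (for geodesics) are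
  strictly convex and depend on the eigenvalues only, so in that case the end points coincide.

  For segments majorization is the Schur--Ky Fan argument: in an eigenbasis of the intermediate matrix
  the vector \<open>c\<close> is a combination of two diagonals, and the squares of the entries of an
  orthogonal matrix form a doubly stochastic matrix (\<open>partial_diagonal_sum_le\<close>).

  For geodesics, majorization uses only the determinant of the intermediate matrix \<open>C\<close> and
  the bound of its quadratic form by the weighted geometric mean of the forms of the end points, which
  is Hoelder's inequality in a basis that diagonalises both end points. This bound passes to
  principal blocks, and from forms to determinants: in a basis where both outer forms are diagonal,
  Hadamard's inequality compares the determinant of the middle form with the product of its diagonal
  (\<open>det_le_of_form_le_geometric_mean\<close>). Principal minors of the end points are bounded by products
  of their largest eigenvalues after all eigenvalues below a threshold have been raised
  to that threshold (\<open>det_principal_block_le\<close>, \<open>log_eigenvalue_partial_sums\<close>).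
\<close>

section \<open>Conjugates of diagonal matrices\<close>

definition vmap :: "(real \<Rightarrow> real) \<Rightarrow> real ^ 'n \<Rightarrow> real ^ 'n" where
  "vmap \<phi> d = (\<chi> i. \<phi> (d $ i))"

text \<open>The factor \<open>L\<close> is arbitrary: orthogonal \<open>L\<close> gives spectral decompositions, and invertible \<open>L\<close>
  gives the simultaneous diagonalisation of two quadratic forms by congruence.\<close>

definition conj_diag :: "real ^ 'n ^ 'n \<Rightarrow> real ^ 'n \<Rightarrow> real ^ 'n ^ 'n" where
  "conj_diag L d = L ** diag_matrix d ** transpose L"

lemma vmap_nth [simp]: "vmap \<phi> d $ i = \<phi> (d $ i)"
  by (simp add: vmap_def)

lemma diag_matrix_nth: "diag_matrix d $ i $ j = (if i = j then d $ i else 0)"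
  by (simp add: diag_matrix_def)

lemma transpose_diag_matrix [simp]: "transpose (diag_matrix d) = diag_matrix d"
  by (simp add: transpose_def diag_matrix_def vec_eq_iff)

lemma det_diag_matrix: "det (diag_matrix d) = (\<Prod>i\<in>UNIV. d $ i)"
  by (subst det_diagonal) (auto simp: diag_matrix_nth)

lemma diag_matrix_left_nth: "(diag_matrix d ** M) $ i $ j = d $ i * M $ i $ j"
proof -
  have "(if i = k then d $ i else 0) * M $ k $ j = (if k = i then d $ i * M $ i $ j else 0)" for k
    by simp
  then show ?thesis
    by (simp add: matrix_matrix_mult_def diag_matrix_nth)
qed

lemma diag_matrix_right_nth: "(M ** diag_matrix d) $ i $ j = M $ i $ j * d $ j"
proof -
  have "M $ i $ k * (if k = j then d $ k else 0) = (if k = j then M $ i $ j * d $ j else 0)" for k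
    by simp
  then show ?thesis
    by (simp add: matrix_matrix_mult_def diag_matrix_nth)
qed

lemma diag_matrix_mult: "diag_matrix d ** diag_matrix e = diag_matrix (\<chi> i. d $ i * e $ i)"
  by (simp add: vec_eq_iff diag_matrix_left_nth diag_matrix_nth)

lemma matrix_ring_simps:
  fixes M N R :: "real ^ 'n ^ 'n"
  shows "(M + N) ** R = M ** R + N ** R" "M ** (N + R) = M ** N + M ** R"
    "(M - N) ** R = M ** R - N ** R" "M ** (N - R) = M ** N - M ** R"
    "(- M) ** N = - (M ** N)" "M ** (- N) = - (M ** N)"
    "(c *\<^sub>R M) ** N = c *\<^sub>R (M ** N)" "M ** (c *\<^sub>R N) = c *\<^sub>R (M ** N)"
  by (simp_all add: vec_eq_iff matrix_matrix_mult_def algebra_simps sum.distrib sum_subtractf sum_negf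
      sum_distrib_left)

lemma diag_matrix_add_scaleR:
  "diag_matrix (u *\<^sub>R x + v *\<^sub>R y) = u *\<^sub>R diag_matrix x + v *\<^sub>R diag_matrix y"
  by (simp add: diag_matrix_def vec_eq_iff)

lemma diag_matrix_eq_iff [simp]: "diag_matrix x = diag_matrix y \<longleftrightarrow> x = y"
  by (metis diag_matrix_nth vec_eq_iff)

lemma vmap_exp_eq_iff [simp]: "vmap exp x = vmap exp y \<longleftrightarrow> x = y"
  by (simp add: vec_eq_iff)

lemma conj_diag_nth: "conj_diag L d $ i $ j = (\<Sum>k\<in>UNIV. L $ i $ k * d $ k * L $ j $ k)"
  by (simp add: conj_diag_def matrix_matrix_mult_def transpose_def diag_matrix_nth
      if_distrib cong: if_cong)

lemma conj_diag_id [simp]: "conj_diag (mat 1) d = diag_matrix d"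
  by (simp add: conj_diag_def)

lemma transpose_conj_diag [simp]: "transpose (conj_diag L d) = conj_diag L d"
  by (simp add: conj_diag_def matrix_transpose_mul matrix_mul_assoc)

lemma conj_diag_congruence: "M ** conj_diag L d ** transpose M = conj_diag (M ** L) d"
  by (simp add: conj_diag_def matrix_transpose_mul matrix_mul_assoc)

lemma det_conj_diag: "det (conj_diag L d) = (det L)\<^sup>2 * (\<Prod>i\<in>UNIV. d $ i)"
  by (simp add: conj_diag_def det_mul det_diag_matrix power2_eq_square)

lemma linear_conj_diag: "linear (conj_diag L)"
  by (rule linearI) (auto simp: vec_eq_iff conj_diag_nth sum.distrib sum_distrib_left algebra_simps)

lemma inner_conj_diag:
  "z \<bullet> (conj_diag L d *v z) = (\<Sum>k\<in>UNIV. d $ k * ((z v* L) $ k)\<^sup>2)"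
proof -
  have "z \<bullet> (conj_diag L d *v z) = (z v* L) \<bullet> (diag_matrix d *v (z v* L))"
    by (simp add: conj_diag_def dot_lmul_matrix flip: matrix_vector_mul_assoc)
  then show ?thesis
    by (simp add: inner_vec_def matrix_vector_mult_def diag_matrix_nth power2_eq_square if_distrib
        if_distribR mult_ac cong: if_cong)
qed

lemma orthogonal_matrix_cancel:
  assumes "orthogonal_matrix H"
  shows "transpose H ** H = mat 1" "H ** transpose H = mat 1"
    "M ** transpose H ** H = M" "M ** H ** transpose H = M"
  using assms by (auto simp: orthogonal_matrix_def simp flip: matrix_mul_assoc)

lemma conj_diag_mult:
  assumes "orthogonal_matrix H"
  shows "conj_diag H d ** conj_diag H e = conj_diag H (\<chi> i. d $ i * e $ i)"
  by (simp add: conj_diag_def matrix_mul_assoc orthogonal_matrix_cancel(3)[OF assms]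
      flip: diag_matrix_mult)

lemma conj_diag_one:
  fixes H :: "real ^ 'n ^ 'n"
  assumes "orthogonal_matrix H"
  shows "conj_diag H 1 = mat 1"
proof -
  have "diag_matrix 1 = (mat 1 :: real ^ 'n ^ 'n)"
    by (simp add: diag_matrix_def mat_def vec_eq_iff)
  then show ?thesis
    by (simp add: conj_diag_def orthogonal_matrix_cancel[OF assms])
qed

lemma det_orthogonal_power2:
  fixes H :: "real ^ 'n ^ 'n"
  assumes "orthogonal_matrix H"
  shows "(det H)\<^sup>2 = 1"
  using det_orthogonal_matrix[OF assms] by auto

lemma orthogonal_vector_mult:
  fixes H :: "real ^ 'n ^ 'n"
  assumes "orthogonal_matrix H"
  shows "(\<Sum>k\<in>UNIV. ((z v* H) $ k)\<^sup>2) = z \<bullet> z"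
  using inner_conj_diag[of z H 1] by (simp add: conj_diag_one[OF assms])

lemma orthogonal_row_squares:
  fixes H :: "real ^ 'n ^ 'n"
  assumes "orthogonal_matrix H"
  shows "(\<Sum>k\<in>UNIV. (H $ i $ k)\<^sup>2) = 1"
  using conj_diag_nth[of H 1 i i] conj_diag_one[OF assms]
  by (simp add: mat_def power2_eq_square)

lemma orthogonal_column_squares:
  fixes H :: "real ^ 'n ^ 'n"
  assumes "orthogonal_matrix H"
  shows "(\<Sum>i\<in>UNIV. (H $ i $ k)\<^sup>2) = 1"
  using orthogonal_row_squares[of "transpose H" k, unfolded orthogonal_matrix_transpose, OF assms]
  by (simp add: transpose_def)

lemma trace_conj_diag:
  fixes H :: "real ^ 'n ^ 'n"
  shows "(\<Sum>i\<in>UNIV. conj_diag H d $ i $ i) = (\<Sum>k\<in>UNIV. d $ k * (\<Sum>i\<in>UNIV. (H $ i $ k)\<^sup>2))"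
  unfolding conj_diag_nth sum_distrib_left
  by (subst sum.swap) (simp add: power2_eq_square mult_ac)

lemma trace_orthogonal_conj_diag:
  fixes H :: "real ^ 'n ^ 'n"
  assumes "orthogonal_matrix H"
  shows "(\<Sum>i\<in>UNIV. conj_diag H d $ i $ i) = (\<Sum>k\<in>UNIV. d $ k)"
  by (simp add: trace_conj_diag orthogonal_column_squares[OF assms])

section \<open>The spectral theorem\<close>

text \<open>A maximiser \<open>u\<close> of the quadratic form on the unit sphere of an invariant subspace is an eigenvector,
  and its orthogonal complement in the subspace is again invariant. Formulating the induction
  over subspaces keeps the matrix fixed.\<close>

lemma spectral_subspace:
  fixes A :: "real ^ 'n ^ 'n"
  assumes sym: "transpose A = A" and "subspace V" and "\<And>v. v \<in> V \<Longrightarrow> A *v v \<in> V"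
  shows "\<exists>B. finite B \<and> card B = dim V \<and> B \<subseteq> V \<and> pairwise orthogonal B \<and>
             (\<forall>b\<in>B. norm b = 1 \<and> (\<exists>\<mu>. A *v b = \<mu> *\<^sub>R b))"
  using assms(2,3)
proof (induction "dim V" arbitrary: V)
  case 0
  then show ?case
    by (intro exI[of _ "{}"]) auto
next
  case (Suc n)
  have self_adj: "x \<bullet> (A *v y) = (A *v x) \<bullet> y" for x y
    by (metis dot_lmul_matrix sym transpose_matrix_vector)
  define S where "S = V \<inter> sphere 0 1"
  have "compact S"
    unfolding S_def by (simp add: Suc.prems(1) closed_subspace compact_sphere compact_Int closed_Int_compact)
  moreover have "S \<noteq> {}"
  proof -
    have "\<not> V \<subseteq> {0}"
      using Suc.hyps(2) by (simp flip: dim_eq_0)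
    then obtain v where v: "v \<in> V" "v \<noteq> 0"
      by blast
    then have "inverse (norm v) *\<^sub>R v \<in> S"
      unfolding S_def using subspace_scale[OF Suc.prems(1)] by simp
    then show ?thesis by blast
  qed
  moreover have "continuous_on S (\<lambda>x. x \<bullet> (A *v x))"
    by (intro continuous_intros linear_continuous_on
        matrix_vector_mul_bounded_linear)
  ultimately obtain u where u: "u \<in> S"
    and max: "\<And>x. x \<in> S \<Longrightarrow> x \<bullet> (A *v x) \<le> u \<bullet> (A *v u)"
    using continuous_attains_sup[of S "\<lambda>x. x \<bullet> (A *v x)"] by blast
  define \<mu> where "\<mu> = u \<bullet> (A *v u)"
  have uV: "u \<in> V" and uu: "u \<bullet> u = 1" and nu: "norm u = 1"
    using u by (auto simp: S_def dot_square_norm)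
  have bound: "x \<bullet> (A *v x) \<le> \<mu> * (x \<bullet> x)" if "x \<in> V" for x
  proof (cases "x = 0")
    case False
    define y where "y = inverse (norm x) *\<^sub>R x"
    have "y \<in> S"
      unfolding S_def y_def using subspace_scale[OF Suc.prems(1) that] False by simp
    moreover have "x = norm x *\<^sub>R y"
      using False by (simp add: y_def)
    ultimately show ?thesis
      using max[of y] 
      by (smt (verit) False \<mu>_def dot_square_norm inner_commute inner_scaleR_left
          matrix_vector_mult_scaleR mult.commute mult.left_commute mult_right_mono power2_eq_square
          zero_le_power2)
  qed simp
  \<comment> \<open>First variation at the maximiser: the derivative vanishes along every direction of \<open>V\<close>
    orthogonal to \<open>u\<close>.\<close>
  have variation: "v \<bullet> (A *v u) = 0" if "v \<in> V" "u \<bullet> v = 0" for v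
  proof (rule ccontr)
    assume nz: "v \<bullet> (A *v u) \<noteq> 0"
    define b c where "b = v \<bullet> (A *v u)" and "c = \<mu> * (v \<bullet> v) - v \<bullet> (A *v v)"
    have quad: "2 * s * b \<le> s\<^sup>2 * c" for s
    proof -
      have "u + s *\<^sub>R v \<in> V"
        using uV that(1) Suc.prems(1) by (simp add: subspace_add subspace_scale)
      then have "(u + s *\<^sub>R v) \<bullet> (A *v (u + s *\<^sub>R v)) \<le> \<mu> * ((u + s *\<^sub>R v) \<bullet> (u + s *\<^sub>R v))"
        by (rule bound)
      moreover have "u \<bullet> (A *v v) = b"
        using self_adj[of u v] by (simp add: b_def inner_commute)
      ultimately show ?thesis
        using uu that(2)
        by (simp add: b_def c_def \<mu>_def[symmetric] matrix_vector_mult_add_rdistrib matrix_vector_right_distrib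
            matrix_vector_mult_scaleR inner_add_left inner_add_right inner_commute[of v u]
            algebra_simps power2_eq_square)
    qed
    have c: "\<bar>c\<bar> + 1 > 0" by simp
    \<comment> \<open>The step size is small enough for the linear term to beat the quadratic one, whatever the sign
      of \<open>c\<close>.\<close>
    have "2 * (b / (\<bar>c\<bar> + 1)) * b \<le> (b / (\<bar>c\<bar> + 1))\<^sup>2 * c"
      by (rule quad)
    then have "2 * b\<^sup>2 * (\<bar>c\<bar> + 1) \<le> b\<^sup>2 * c"
      using c by (simp add: divide_simps power2_eq_square split: if_splits)
    then have "2 * (\<bar>c\<bar> + 1) \<le> c"
      using nz by (simp add: b_def mult.assoc mult_le_cancel_left)
    then show False
      by (simp add: abs_if split: if_splits)
  qed
  have eig: "A *v u = \<mu> *\<^sub>R u"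
  proof -
    define w where "w = A *v u - \<mu> *\<^sub>R u"
    have "w \<in> V"
      using uV Suc.prems by (simp add: w_def subspace_diff subspace_scale)
    moreover have "u \<bullet> w = 0"
      by (simp add: w_def inner_diff_right \<mu>_def uu)
    ultimately have "w \<bullet> w = 0"
      using variation[of w] by (simp add: w_def inner_diff_right inner_commute)
    then show ?thesis by (simp add: w_def)
  qed
  define W where "W = {y \<in> V. \<forall>x\<in>span {u}. orthogonal x y}"
  have W_alt: "W = {y \<in> V. u \<bullet> y = 0}"
    by (auto simp: W_def span_singleton orthogonal_def)
  have "dim W + dim (span {u}) = dim V"
    unfolding W_def using uV Suc.prems(1)
    by (intro dim_subspace_orthogonal_to_vectors) (auto simp: span_minimal)
  moreover have "dim {u} = 1"
    using nu by (auto simp: dim_insert)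
  ultimately have dimW: "n = dim W"
    using Suc.hyps(2) by simp
  have "subspace W"
    unfolding W_alt using Suc.prems(1)
    by (auto simp: subspace_def inner_add_right)
  moreover have "A *v w \<in> W" if "w \<in> W" for w
    using that Suc.prems(2) self_adj[of u w] by (auto simp: W_alt eig)
  ultimately obtain B where B: "finite B" "card B = dim W" "B \<subseteq> W" "pairwise orthogonal B"
      "\<forall>b\<in>B. norm b = 1 \<and> (\<exists>\<mu>. A *v b = \<mu> *\<^sub>R b)"
    using Suc.hyps(1)[OF dimW] by blast
  have orth: "orthogonal u b" if "b \<in> B" for b
    using that B(3) by (auto simp: W_alt orthogonal_def)
  have "u \<notin> B"
    using orth uu by (force simp: orthogonal_def)
  then show ?case
    using B orth uV nu eig dimW Suc.hyps(2)
    by (intro exI[of _ "insert u B"])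
      (auto simp: pairwise_insert W_alt orthogonal_commute)
qed

definition decreasing :: "real ^ 'n::{finite,linorder} \<Rightarrow> bool" where
  "decreasing a \<longleftrightarrow> (\<forall>i j. i \<le> j \<longrightarrow> a $ j \<le> a $ i)"

text \<open>A permutation that maximises the sum of \<open>a\<close> against strictly decreasing weights must sort \<open>a\<close>:
  otherwise exchanging two entries in the wrong order would increase the sum.\<close>

lemma sorting_permutation:
  fixes a :: "'n::{finite,linorder} \<Rightarrow> real"
  shows "\<exists>p. p permutes UNIV \<and> (\<forall>i j. i \<le> j \<longrightarrow> a (p j) \<le> a (p i))"
proof -
  define w where "w i = real (card {j::'n. i \<le> j})" for i
  define S where "S p = (\<Sum>i\<in>UNIV. w i * a (p i))" for p
  have w: "w j < w i" if "i < j" for i j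
  proof -
    have "{k. j \<le> k} \<subset> {k. i \<le> k}"
    proof
      show "{k. j \<le> k} \<noteq> {k. i \<le> k}"
        using that by (metis leD mem_Collect_eq order.refl)
    qed (use that in auto)
    then show ?thesis
      by (simp add: w_def psubset_card_mono)
  qed
  have fin: "finite (S ` {p::'n \<Rightarrow> 'n. p permutes UNIV})"
    by (simp add: finite_permutations)
  moreover have "S ` {p::'n \<Rightarrow> 'n. p permutes UNIV} \<noteq> {}"
    using permutes_id by blast
  ultimately have "Max (S ` {p. p permutes UNIV}) \<in> S ` {p. p permutes UNIV}"
    by (rule Max_in)
  then obtain p where p: "p permutes UNIV" and max: "\<And>q. q permutes UNIV \<Longrightarrow> S q \<le> S p"
    using Max_ge[OF fin] by fastforce
  have "a (p j) \<le> a (p i)" if "i \<le> j" for i j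
  proof (rule ccontr)
    assume less: "\<not> a (p j) \<le> a (p i)"
    with that have ij: "i < j"
      by (metis order.order_iff_strict order.refl)
    define q where "q = p \<circ> Transposition.transpose i j"
    have "q permutes UNIV"
      unfolding q_def using p by (intro permutes_compose permutes_swap_id) auto
    have split: "sum g UNIV = g i + g j + sum g (UNIV - {i, j})" for g :: "'n \<Rightarrow> real"
      using ij by (subst sum.subset_diff[of "{i, j}"]) (auto simp: ac_simps)
    have "sum (\<lambda>k. w k * a (q k)) (UNIV - {i, j}) = sum (\<lambda>k. w k * a (p k)) (UNIV - {i, j})"
      by (intro sum.cong) (auto simp: q_def transpose_def)
    then have "S q - S p = (w i - w j) * (a (p j) - a (p i))"
      unfolding S_def split[of "\<lambda>k. w k * a (q k)"] split[of "\<lambda>k. w k * a (p k)"]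
      by (simp add: q_def algebra_simps)
    also have "\<dots> > 0"
      using w[OF ij] less by simp
    finally show False
      using max[OF \<open>q permutes UNIV\<close>] by simp
  qed
  with p show ?thesis by blast
qed

lemma orthonormal_eigenvectors:
  fixes A :: "real ^ 'n ^ 'n"
  assumes "transpose A = A"
  obtains h :: "'n \<Rightarrow> real ^ 'n" and d :: "'n \<Rightarrow> real"
  where "\<And>i j. h i \<bullet> h j = (if i = j then 1 else 0)" "\<And>i. A *v h i = d i *\<^sub>R h i"
proof -
  obtain B where B: "finite B" "card B = CARD('n)" "pairwise orthogonal B"
      "\<And>b. b \<in> B \<Longrightarrow> norm b = 1 \<and> (\<exists>\<mu>. A *v b = \<mu> *\<^sub>R b)"
    using spectral_subspace[OF assms subspace_UNIV] by (auto simp: dim_UNIV)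
  obtain h where h: "bij_betw h (UNIV :: 'n set) B"
    using finite_same_card_bij[of "UNIV :: 'n set" B] B by auto
  have hB: "h i \<in> B" for i
    using h by (auto simp: bij_betw_def)
  have "h i \<bullet> h j = (if i = j then 1 else 0)" for i j
  proof (cases "i = j")
    case False
    then have "h i \<noteq> h j"
      using bij_betw_imp_inj_on[OF h] by (simp add: inj_eq)
    then show ?thesis
      using B(3) hB False by (simp add: pairwise_def orthogonal_def)
  qed (use B(4)[OF hB] in \<open>simp add: norm_eq_1\<close>)
  moreover have "\<exists>d. \<forall>i. A *v h i = d i *\<^sub>R h i"
    using B(4)[OF hB] by metis
  ultimately show ?thesis
    using that by blast
qed

text \<open>The order of the eigenvalues may be prescribed: \<open>P\<close> stands for any property that a suitable
  rearrangement of the eigenvalues has, so that sorted and unsorted decompositions come from one proof.\<close>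

lemma spectral_theorem_rearranged:
  fixes A :: "real ^ 'n ^ 'n"
  assumes "transpose A = A" and "\<And>d :: 'n \<Rightarrow> real. \<exists>p. p permutes UNIV \<and> P (\<chi> i. d (p i))"
  obtains H d where "orthogonal_matrix H" "A = conj_diag H d" "P d"
proof -
  obtain h d where h: "\<And>i j :: 'n. h i \<bullet> h j = (if i = j then 1 else 0)"
      and eig: "\<And>i. A *v h i = d i *\<^sub>R h i"
    using orthonormal_eigenvectors[OF assms(1)] by metis
  obtain p where p: "p permutes UNIV" and P: "P (\<chi> i. d (p i))"
    using assms(2) by blast
  define H where "H = (\<chi> i j. h (p j) $ i)"
  have col: "column j H = h (p j)" for j
    by (simp add: H_def column_def)
  then have H: "orthogonal_matrix H"
    using permutes_inj[OF p]
    by (simp add: orthogonal_matrix matrix_mult_transpose_dot_column col h mat_def inj_eq)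
  have "(A ** H) $ i $ j = (H ** diag_matrix (\<chi> i. d (p i))) $ i $ j" for i j
  proof -
    have "(A ** H) $ i $ j = (A *v h (p j)) $ i"
      by (simp add: matrix_matrix_mult_def matrix_vector_mult_def H_def)
    also have "\<dots> = d (p j) * h (p j) $ i"
      by (simp add: eig)
    finally show ?thesis
      by (simp add: matrix_matrix_mult_def diag_matrix_nth H_def if_distrib cong: if_cong)
  qed
  then have "A ** H = H ** diag_matrix (\<chi> i. d (p i))"
    by (simp add: vec_eq_iff)
  then have "A = conj_diag H (\<chi> i. d (p i))"
    unfolding conj_diag_def by (metis orthogonal_matrix_cancel(4)[OF H])
  with H P show ?thesis
    using that by blast
qed

lemma spectral_theorem:
  fixes A :: "real ^ 'n ^ 'n"
  assumes "transpose A = A"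
  obtains H d where "orthogonal_matrix H" "A = conj_diag H d"
  using spectral_theorem_rearranged[OF assms, of "\<lambda>_. True"] permutes_id by blast

lemma spectral_theorem_decreasing:
  fixes A :: "real ^ 'n::{finite,linorder} ^ 'n::{finite,linorder}"
  assumes "transpose A = A"
  obtains H d where "orthogonal_matrix H" "A = conj_diag H d" "decreasing d"
  using spectral_theorem_rearranged[OF assms, of decreasing] sorting_permutation
  by (auto simp: decreasing_def)

section \<open>Positive definite matrices and geodesics\<close>

lemma pos_def_conj_diag_iff:
  fixes H :: "real ^ 'n ^ 'n"
  assumes H: "orthogonal_matrix H"
  shows "pos_def (conj_diag H d) \<longleftrightarrow> (\<forall>i. 0 < d $ i)"
proof
  assume *: "pos_def (conj_diag H d)"
  show "\<forall>i. 0 < d $ i"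
  proof
    fix i
    have e: "(H *v axis i 1) v* H = axis i 1"
      by (metis H orthogonal_matrix_def matrix_vector_mul_assoc matrix_vector_mul_lid
          transpose_matrix_vector)
    then have "H *v axis i 1 \<noteq> 0"
      by (metis axis_eq_0_iff vector_matrix_mult_0 zero_neq_one)
    then have "0 < (H *v axis i 1) \<bullet> (conj_diag H d *v (H *v axis i 1))"
      using * by (auto simp: pos_def_def)
    then have "0 < (\<Sum>k\<in>UNIV. d $ k * ((axis i 1 :: real ^ 'n) $ k)\<^sup>2)"
      by (simp only: inner_conj_diag e)
    then show "0 < d $ i"
      by (simp add: axis_def if_distrib if_distribR cong: if_cong)
  qed
next
  assume d: "\<forall>i. 0 < d $ i"
  have "0 < z \<bullet> (conj_diag H d *v z)" if "z \<noteq> 0" for z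
  proof -
    have "0 < (\<Sum>k\<in>UNIV. ((z v* H) $ k)\<^sup>2)"
      using that orthogonal_vector_mult[OF H] by simp
    then obtain k where "(z v* H) $ k \<noteq> 0"
      by (metis (no_types, lifting) less_irrefl power_zero_numeral sum.neutral)
    with d show ?thesis
      unfolding inner_conj_diag
      by (intro sum_pos2[of _ k]) (auto simp: less_imp_le)
  qed
  then show "pos_def (conj_diag H d)"
    by (simp add: pos_def_def)
qed

lemma pos_def_congruence:
  fixes A M :: "real ^ 'n ^ 'n"
  assumes "pos_def A" "det M \<noteq> 0"
  shows "pos_def (M ** A ** transpose M)"
proof -
  have "z \<bullet> ((M ** A ** transpose M) *v z) = (z v* M) \<bullet> (A *v (z v* M))" for z
    by (simp add: dot_lmul_matrix flip: matrix_vector_mul_assoc)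
  moreover have "z v* M \<noteq> 0" if "z \<noteq> 0" for z
  proof
    assume "z v* M = 0"
    then have "transpose M *v z = 0" by simp
    moreover have "invertible (transpose M)"
      using assms(2) by (simp add: invertible_det_nz)
    ultimately show False
      using that by (metis matrix_left_invertible_ker invertible_def)
  qed
  ultimately show ?thesis
    using assms(1) by (auto simp: pos_def_def matrix_transpose_mul matrix_mul_assoc)
qed

lemma vmap_exp_ln:
  assumes "\<forall>i. 0 < d $ i"
  shows "d = vmap exp (vmap ln d)"
  using assms by (simp add: vec_eq_iff)

text \<open>Writing the positive eigenvalues as exponentials turns powers, products and determinants
  into linear operations on the exponent vector.\<close>

lemma pos_def_spectral_exp:
  fixes A :: "real ^ 'n ^ 'n"
  assumes "pos_def A"
  obtains H a where "orthogonal_matrix H" "A = conj_diag H (vmap exp a)"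
  using assms by (metis pos_def_def pos_def_conj_diag_iff spectral_theorem vmap_exp_ln)

lemma pos_def_spectral_exp_decreasing:
  fixes A :: "real ^ 'n::{finite,linorder} ^ 'n::{finite,linorder}"
  assumes "pos_def A"
  obtains H a where "orthogonal_matrix H" "A = conj_diag H (vmap exp a)" "decreasing a"
proof -
  obtain H d where H: "orthogonal_matrix H" "A = conj_diag H d" "decreasing d"
    using assms spectral_theorem_decreasing unfolding pos_def_def by blast
  then have d: "\<forall>i. 0 < d $ i"
    using assms pos_def_conj_diag_iff by blast
  show ?thesis
    using that[OF H(1), of "vmap ln d"] H d vmap_exp_ln[OF d] by (simp add: decreasing_def)
qed

lemma pos_def_conj_diag_exp:
  fixes H :: "real ^ 'n ^ 'n"
  shows "orthogonal_matrix H \<Longrightarrow> pos_def (conj_diag H (vmap exp a))"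
  by (simp add: pos_def_conj_diag_iff)

text \<open>If \<open>U = G\<^sup>T H\<close> then equality of the two matrices means \<open>U\<^sub>i\<^sub>j d\<^sub>j = e\<^sub>i U\<^sub>i\<^sub>j\<close>, that is, \<open>d\<^sub>j = e\<^sub>i\<close>
  wherever \<open>U\<^sub>i\<^sub>j \<noteq> 0\<close>; this persists when a function is applied to \<open>d\<close> and \<open>e\<close>. It makes the
  real powers of a matrix well defined.\<close>

lemma functional_calculus_unique:
  assumes H: "orthogonal_matrix H" and G: "orthogonal_matrix G"
    and eq: "conj_diag H d = conj_diag G e"
  shows "conj_diag H (vmap \<phi> d) = conj_diag G (vmap \<phi> e)"
proof -
  define U where "U = transpose G ** H"
  have *: "(U ** diag_matrix x = diag_matrix y ** U) \<longleftrightarrow> conj_diag H x = conj_diag G y" for x y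
  proof -
    have "conj_diag H x = conj_diag G y
      \<longleftrightarrow> transpose G ** conj_diag H x ** H = transpose G ** conj_diag G y ** H"
    proof
      assume *: "transpose G ** conj_diag H x ** H = transpose G ** conj_diag G y ** H"
      have "conj_diag H x = G ** (transpose G ** conj_diag H x ** H) ** transpose H" for x
        by (simp add: matrix_mul_assoc orthogonal_matrix_cancel[OF H] orthogonal_matrix_cancel[OF G])
      moreover have "conj_diag G y = G ** (transpose G ** conj_diag G y ** H) ** transpose H" for x
        by (simp add: matrix_mul_assoc orthogonal_matrix_cancel[OF H] orthogonal_matrix_cancel[OF G])
      ultimately show "conj_diag H x = conj_diag G y"
        using * by metis
    qed simp
    then show ?thesis
      by (simp add: U_def conj_diag_def matrix_mul_assoc orthogonal_matrix_cancel[OF H]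
          orthogonal_matrix_cancel[OF G])
  qed
  have entry: "(U ** diag_matrix x = diag_matrix y ** U)
      \<longleftrightarrow> (\<forall>i j. U $ i $ j * x $ j = y $ i * U $ i $ j)" for x y
    by (simp add: vec_eq_iff matrix_matrix_mult_def diag_matrix_nth if_distrib if_distribR cong: if_cong)
  have "U $ i $ j * \<phi> (d $ j) = \<phi> (e $ i) * U $ i $ j" for i j
    using eq[folded *, unfolded entry] by (metis mult.commute mult_cancel_left)
  then show ?thesis
    by (simp add: * [symmetric] entry)
qed

lemma mpow_conj_diag:
  assumes "orthogonal_matrix H"
  shows "mpow (conj_diag H d) t = conj_diag H (vmap (\<lambda>x. x powr t) d)"
proof -
  have "mpow (conj_diag H d) t = (THE B. \<exists>G e. orthogonal_matrix G \<and>
      conj_diag H d = conj_diag G e \<and> B = conj_diag G (vmap (\<lambda>x. x powr t) e))"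
    by (simp add: mpow_def conj_diag_def vmap_def)
  also have "\<dots> = conj_diag H (vmap (\<lambda>x. x powr t) d)"
    using assms
    by (intro the_equality) (auto intro: functional_calculus_unique[OF assms, symmetric])
  finally show ?thesis .
qed

lemma mpow_conj_diag_exp:
  assumes "orthogonal_matrix H"
  shows "mpow (conj_diag H (vmap exp a)) t = conj_diag H (vmap exp (t *\<^sub>R a))"
  by (simp add: mpow_conj_diag[OF assms] vmap_def exp_powr_real mult.commute)

lemma matrix_power_conj_diag:
  fixes H :: "real ^ 'n ^ 'n"
  assumes "orthogonal_matrix H"
  shows "((\<lambda>B. conj_diag H d ** B) ^^ n) (mat 1) = conj_diag H (vmap (\<lambda>x. x ^ n) d)"
proof (induction n)
  case 0
  have "vmap (\<lambda>x. x ^ 0) d = 1" by (simp add: vec_eq_iff)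
  then show ?case
    using conj_diag_one[OF assms] by simp
qed (simp add: conj_diag_mult[OF assms] vmap_def)

lemma matrix_exp_conj_diag:
  fixes H :: "real ^ 'n ^ 'n"
  assumes "orthogonal_matrix H"
  shows "matrix_exp (conj_diag H d) = conj_diag H (vmap exp d)"
proof -
  have "(\<lambda>n. vmap (\<lambda>x. x ^ n /\<^sub>R fact n) d) sums vmap exp d"
  proof -
    have "(\<lambda>k. (\<Sum>n<k. vmap (\<lambda>x. x ^ n /\<^sub>R fact n) d) $ i) \<longlonglongrightarrow> vmap exp d $ i" for i
      using exp_converges[of "d $ i"] by (simp add: sums_def sum_component)
    then show ?thesis
      unfolding sums_def by (intro vec_tendstoI)
  qed
  then have "(\<lambda>n. conj_diag H (vmap (\<lambda>x. x ^ n /\<^sub>R fact n) d)) sums conj_diag H (vmap exp d)"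
    by (rule bounded_linear.sums[OF linear_linear[THEN iffD2, OF linear_conj_diag]])
  moreover have "conj_diag H (vmap (\<lambda>x. x ^ n /\<^sub>R fact n) d)
      = ((\<lambda>B. conj_diag H d ** B) ^^ n) (mat 1) /\<^sub>R fact n" for n
    unfolding matrix_power_conj_diag[OF assms]
    by (subst linear_cmul[OF linear_conj_diag, symmetric]) (simp add: vmap_def vec_eq_iff scaleR_vec_def)
  ultimately show ?thesis
    unfolding matrix_exp_def by (metis (no_types, lifting) sums_unique ext)
qed

text \<open>With \<open>A\<^sup>-\<^sup>1\<^sup>/\<^sup>2 B A\<^sup>-\<^sup>1\<^sup>/\<^sup>2 = U diag(exp d) U\<^sup>T\<close> the congruence by \<open>L = A\<^sup>1\<^sup>/\<^sup>2 U\<close> diagonalises both end points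
  and the whole geodesic, which becomes linear in the exponent. Besides describing the geodesic, this is
  the simultaneous diagonalisation of two positive definite forms.\<close>

lemma geodesic_representation:
  fixes A B :: "real ^ 'n ^ 'n"
  assumes "pos_def A" "pos_def B"
  obtains L d where "det L \<noteq> 0" "A = conj_diag L 1" "B = conj_diag L (vmap exp d)"
    "\<And>t. geodesic A B t = conj_diag L (vmap exp (t *\<^sub>R d))"
proof -
  obtain G a where G: "orthogonal_matrix G" and A: "A = conj_diag G (vmap exp a)"
    using pos_def_spectral_exp[OF assms(1)] .
  define R where "R = (\<lambda>s. conj_diag G (vmap exp (s *\<^sub>R a)))"
  have R: "mpow A s = R s" for s
    by (simp add: A R_def mpow_conj_diag_exp[OF G])
  have RR: "R s ** R t = R (s + t)" for s t
    by (simp add: R_def conj_diag_mult[OF G] vmap_def exp_add scaleR_left.add distrib_right)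
  have R0: "R 0 = mat 1"
    using conj_diag_one[OF G] by (simp add: R_def vmap_def one_vec_def)
  have sym: "transpose (R s) = R s" for s
    by (simp add: R_def)
  have detR: "det (R s) \<noteq> 0" for s
    using det_orthogonal_power2[OF G] by (simp add: R_def det_conj_diag)
  have "pos_def (R (- 1/2) ** B ** R (- 1/2))"
    using pos_def_congruence[OF assms(2) detR, of "- 1/2"] by (simp add: sym)
  then obtain U d where U: "orthogonal_matrix U"
      and N: "R (- 1/2) ** B ** R (- 1/2) = conj_diag U (vmap exp d)"
    using pos_def_spectral_exp by blast
  define L where "L = R (1/2) ** U"
  have RU: "R (1/2) ** conj_diag U e ** R (1/2) = conj_diag L e" for e
    using conj_diag_congruence[of "R (1/2)" U e] by (simp add: sym L_def)
  have "R (1/2) ** (R (- 1/2) ** B ** R (- 1/2)) ** R (1/2)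
      = (R (1/2) ** R (- 1/2)) ** B ** (R (- 1/2) ** R (1/2))"
    by (simp only: matrix_mul_assoc)
  then have B: "B = conj_diag L (vmap exp d)"
    unfolding N RU by (simp add: RR R0)
  have "R (1/2) ** R (1/2) = A"
    by (simp add: RR) (simp add: R_def A)
  then have A': "A = conj_diag L 1"
    using RU[of 1] by (simp add: conj_diag_one[OF U])
  have "det L \<noteq> 0"
    using detR det_orthogonal_power2[OF U] by (auto simp: L_def det_mul)
  moreover have "geodesic A B t = conj_diag L (vmap exp (t *\<^sub>R d))" for t
    by (simp only: geodesic_def R N mpow_conj_diag_exp[OF U] RU)
  ultimately show ?thesis
    using that A' B by blast
qed

lemma diag_matrix_exp_mult:
  "diag_matrix (vmap exp x) ** diag_matrix (vmap exp y) = diag_matrix (vmap exp (x + y))"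
  by (simp add: diag_matrix_mult vmap_def exp_add)

lemma geodesic_diag_matrix:
  fixes x y :: "real ^ 'n"
  shows "geodesic (diag_matrix (vmap exp x)) (diag_matrix (vmap exp y)) t
    = diag_matrix (vmap exp ((1 - t) *\<^sub>R x + t *\<^sub>R y))"
proof -
  have mpow: "mpow (diag_matrix (vmap exp z)) s = diag_matrix (vmap exp (s *\<^sub>R z))"
    for z :: "real ^ 'n" and s
    using mpow_conj_diag_exp[OF orthogonal_matrix_id, of z s] by simp
  have "(1/2) *\<^sub>R x + t *\<^sub>R ((- 1/2) *\<^sub>R x + y + (- 1/2) *\<^sub>R x) + (1/2) *\<^sub>R x
      = (1 - t) *\<^sub>R x + t *\<^sub>R y"
    by (simp add: vec_eq_iff algebra_simps)
  then show ?thesis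
    by (simp only: geodesic_def mpow diag_matrix_exp_mult)
qed

lemma det_char_conj_diag:
  fixes H :: "real ^ 'n ^ 'n"
  assumes "orthogonal_matrix H"
  shows "det (mat x - conj_diag H d) = (\<Prod>i\<in>UNIV. x - d $ i)"
proof -
  have "mat x = conj_diag H (x *\<^sub>R 1)"
    unfolding linear_cmul[OF linear_conj_diag] conj_diag_one[OF assms]
    by (simp add: mat_def vec_eq_iff)
  then have "mat x - conj_diag H d = conj_diag H (x *\<^sub>R 1 - d)"
    by (simp add: linear_diff[OF linear_conj_diag])
  then show ?thesis
    by (simp add: det_conj_diag det_orthogonal_power2[OF assms])
qed

text \<open>\<open>f\<close> is tied to \<open>F\<close> through eigenvalues in decreasing order; its symmetry makes the relation hold
  for exponent vectors in any order.\<close>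

lemma corresponding_fun_conj_diag:
  fixes H :: "real ^ 'n::{finite,linorder} ^ 'n::{finite,linorder}"
  assumes "corresponding_fun F f" and H: "orthogonal_matrix H"
  shows "F (conj_diag H (vmap exp a)) = f a"
proof -
  obtain p where p: "p permutes UNIV" and sorted: "\<And>i j. i \<le> j \<Longrightarrow> a $ p j \<le> a $ p i"
    using sorting_permutation[of "\<lambda>i. a $ i"] by blast
  define l where "l = (\<chi> i. exp (a $ p i))"
  have "(\<Prod>i\<in>UNIV. x - l $ i) = (\<Prod>i\<in>UNIV. x - exp (a $ i))" for x
    using prod.permute[OF p, of "\<lambda>i. x - exp (a $ i)"] by (simp add: l_def comp_def)
  then have "ordered_eigenvalues (conj_diag H (vmap exp a)) l"
    using sorted by (simp add: ordered_eigenvalues_def det_char_conj_diag[OF H] l_def)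
  then have "F (conj_diag H (vmap exp a)) = f (\<chi> i. a $ p i)"
    using assms(1) pos_def_conj_diag_exp[OF H, of a] by (simp add: corresponding_fun_def l_def)
  also have "\<dots> = f a"
    using assms(1) p by (auto simp: corresponding_fun_def symmetric_fun_def)
  finally show ?thesis .
qed

section \<open>Majorization and symmetric convex functions\<close>

text \<open>Only partial sums of \<open>x\<close> over initial segments occur, so this is the usual majorization when \<open>x\<close>
  is decreasing, and a stronger relation otherwise. Asking for all index sets \<open>K\<close> of the
  right size avoids sorting \<open>c\<close>.\<close>

definition majorizes :: "real ^ 'n::{finite,linorder} \<Rightarrow> real ^ 'n::{finite,linorder} \<Rightarrow> bool" where
  "majorizes x c \<longleftrightarrow>
     (\<forall>m K. card K = card {..m} \<longrightarrow> (\<Sum>i\<in>K. c $ i) \<le> (\<Sum>i\<in>{..m}. x $ i)) \<and>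
     (\<Sum>i\<in>UNIV. c $ i) = (\<Sum>i\<in>UNIV. x $ i)"

definition rearrangements :: "real ^ 'n \<Rightarrow> (real ^ 'n) set" where
  "rearrangements x = {(\<chi> i. x $ p i) | p. p permutes UNIV}"

text \<open>Abel summation: with decreasing weights \<open>g\<close>, the weighted sum is a combination with nonnegative
  coefficients of the partial sums of \<open>d\<close>, plus the full sum weighted by the least value of \<open>g\<close>. The free lower bound
  \<open>\<gamma>\<close> is what lets the induction append a new largest index.\<close>

lemma abel_summation_bound:
  fixes g d :: "'n::linorder \<Rightarrow> real"
  assumes "finite S" and "\<And>i j. i \<le> j \<Longrightarrow> g j \<le> g i"
    and "\<And>m. m \<in> S \<Longrightarrow> 0 \<le> (\<Sum>i\<in>{i \<in> S. i \<le> m}. d i)" and "\<And>i. i \<in> S \<Longrightarrow> \<gamma> \<le> g i"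
  shows "\<gamma> * (\<Sum>i\<in>S. d i) \<le> (\<Sum>i\<in>S. g i * d i)"
  using assms(1,3,4)
proof (induction S arbitrary: \<gamma> rule: finite_linorder_max_induct)
  case (insert b S)
  have "b \<notin> S"
    using insert by auto
  have "{i \<in> insert b S. i \<le> m} = {i \<in> S. i \<le> m}" if "m \<in> S" for m
    using insert.hyps(2) that by auto
  then have "g b * (\<Sum>i\<in>S. d i) \<le> (\<Sum>i\<in>S. g i * d i)"
    using insert.prems(1) insert.hyps(2) assms(2)
    by (intro insert.IH) (metis insertI2, simp add: less_imp_le)
  then have "g b * (\<Sum>i\<in>insert b S. d i) \<le> (\<Sum>i\<in>insert b S. g i * d i)"
    using \<open>b \<notin> S\<close> insert.hyps(1) by (simp add: distrib_left)
  moreover have "{i \<in> insert b S. i \<le> b} = insert b S"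
    using insert.hyps(2) by auto
  then have "\<gamma> * (\<Sum>i\<in>insert b S. d i) \<le> g b * (\<Sum>i\<in>insert b S. d i)"
    using insert.prems[of b] by (intro mult_right_mono) auto
  ultimately show ?case by linarith
qed simp

lemma rearrangements_sum:
  assumes "c \<in> rearrangements a"
  shows "(\<Sum>i\<in>UNIV. h (c $ i)) = (\<Sum>i\<in>UNIV. h (a $ i))"
proof -
  obtain p where "p permutes UNIV" "c = (\<chi> i. a $ p i)"
    using assms by (auto simp: rearrangements_def)
  then show ?thesis
    using sum.permute[of p UNIV "\<lambda>i. h (a $ i)"] by (simp add: comp_def)
qed

lemma finite_rearrangements: "finite (rearrangements (x :: real ^ 'n))"
proof -
  have "rearrangements x = (\<lambda>p. \<chi> i. x $ p i) ` {p. p permutes UNIV}"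
    by (auto simp: rearrangements_def)
  then show ?thesis
    by (simp add: finite_permutations)
qed

text \<open>If \<open>c\<close> were outside the hull, some linear functional would separate it from all rearrangements of
  \<open>x\<close>. Sort the coefficients of the functional in decreasing order along \<open>p\<close>; by Abel summation the
  rearrangement of \<open>x\<close> that follows \<open>p\<close> does at least as well as \<open>c\<close>, a contradiction.\<close>

lemma majorizes_imp_convex_hull:
  assumes "majorizes x c"
  shows "c \<in> convex hull (rearrangements x)"
proof (rule ccontr)
  assume "c \<notin> convex hull (rearrangements x)"
  then obtain a b where ac: "a \<bullet> c < b" and ay: "\<And>y. y \<in> convex hull (rearrangements x) \<Longrightarrow> b < a \<bullet> y"
    using separating_hyperplane_closed_point[of "convex hull (rearrangements x)" c]
    by (auto simp: finite_rearrangements finite_imp_compact_convex_hull compact_imp_closed)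
  \<comment> \<open>The separation puts \<open>c\<close> below the hull, so the functional to be sorted is \<open>- a\<close>.\<close>
  obtain p where p: "p permutes UNIV" and sorted: "\<And>i j. i \<le> j \<Longrightarrow> - a $ p j \<le> - a $ p i"
    using sorting_permutation[of "\<lambda>i. - a $ i"] by blast
  define d where "d i = x $ i - c $ p i" for i
  define \<gamma> where "\<gamma> = Min (range (\<lambda>i. - a $ p i))"
  have reindex: "(\<Sum>i\<in>UNIV. h (p i)) = (\<Sum>i\<in>UNIV. h i)" for h :: "_ \<Rightarrow> real"
    using sum.permute[OF p, of h] by (simp add: comp_def)
  have "0 \<le> (\<Sum>i\<in>{i \<in> UNIV. i \<le> m}. d i)" for m
  proof -
    have inj: "inj_on p {..m}"
      using permutes_inj[OF p] by (rule inj_on_subset) simp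
    have "(\<Sum>i\<in>p ` {..m}. c $ i) \<le> (\<Sum>i\<in>{..m}. x $ i)"
      using assms card_image[OF inj] by (simp add: majorizes_def)
    moreover have "{i \<in> UNIV. i \<le> m} = {..m}"
      by auto
    ultimately show ?thesis
      by (simp add: d_def sum_subtractf sum.reindex[OF inj])
  qed
  then have "\<gamma> * (\<Sum>i\<in>UNIV. d i) \<le> (\<Sum>i\<in>UNIV. - a $ p i * d i)"
    by (intro abel_summation_bound sorted) (auto simp: \<gamma>_def)
  moreover have "(\<Sum>i\<in>UNIV. d i) = 0"
    using assms reindex[of "\<lambda>i. c $ i"] by (simp add: d_def sum_subtractf majorizes_def)
  ultimately have "(\<Sum>i\<in>UNIV. a $ p i * x $ i) \<le> (\<Sum>i\<in>UNIV. a $ p i * c $ p i)"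
    by (simp add: d_def algebra_simps sum_subtractf sum_negf sum.distrib)
  also have "\<dots> = a \<bullet> c"
    using reindex[of "\<lambda>i. a $ i * c $ i"] by (simp add: inner_vec_def)
  finally have "(\<Sum>i\<in>UNIV. a $ p i * x $ i) \<le> a \<bullet> c" .
  moreover have "(\<Sum>i\<in>UNIV. a $ p i * x $ i) = a \<bullet> (\<chi> i. x $ inv p i)"
    using reindex[of "\<lambda>i. a $ i * x $ inv p i"] permutes_inverses[OF p] by (simp add: inner_vec_def)
  moreover have "(\<chi> i. x $ inv p i) \<in> rearrangements x"
    using permutes_inv[OF p] by (auto simp: rearrangements_def)
  ultimately show False
    using ac ay[of "\<chi> i. x $ inv p i"] hull_inc by fastforce
qed

lemma symmetric_fun_rearrangements:
  "symmetric_fun f \<Longrightarrow> y \<in> rearrangements x \<Longrightarrow> f y = f x"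
  by (auto simp: symmetric_fun_def rearrangements_def)

lemma symmetric_convex_majorizes:
  assumes "symmetric_fun f" "convex_on UNIV f" "majorizes x c"
  shows "f c \<le> f x"
  using convex_on_convex_hull_bound[of "rearrangements x" f "f x"] assms
    majorizes_imp_convex_hull[OF assms(3)] symmetric_fun_rearrangements[OF assms(1)]
  by (metis convex_convex_hull convex_on_subset order.refl subset_UNIV)

text \<open>For strictly convex \<open>f\<close> the set of points that are either strictly below the level \<open>f x\<close> or
  rearrangements of \<open>x\<close> is convex: a proper combination of two different points of the closed
  sublevel set is strictly below. It therefore contains the hull of the rearrangements.\<close>

lemma symmetric_strictly_convex_majorizes:
  assumes f: "symmetric_fun f" and sc: "strictly_convex_on UNIV f" and "majorizes x c"
    and "c \<notin> rearrangements x"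
  shows "f c < f x"
proof -
  define T where "T = {z. f z < f x} \<union> rearrangements x"
  have le: "f z \<le> f x" if "z \<in> T" for z
    using that symmetric_fun_rearrangements[OF f] by (fastforce simp: T_def)
  have "convex T"
  proof (rule convexI)
    fix y z u v assume *: "y \<in> T" "z \<in> T" "0 \<le> u" "0 \<le> v" "u + v = (1::real)"
    show "u *\<^sub>R y + v *\<^sub>R z \<in> T"
    proof (cases "y = z \<or> u = 0 \<or> v = 0")
      case True
      then show ?thesis
        using * by (auto simp flip: scaleR_add_left)
    next
      case False
      then have "f (u *\<^sub>R y + v *\<^sub>R z) < u * f y + v * f z"
        using sc * by (simp add: strictly_convex_on_def)
      also have "\<dots> \<le> u * f x + v * f x"
        using * le by (intro add_mono mult_left_mono) auto
      also have "\<dots> = f x"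
        using * by (simp flip: distrib_right)
      finally show ?thesis
        by (simp add: T_def)
    qed
  qed
  then have "convex hull (rearrangements x) \<subseteq> T"
    by (intro hull_minimal) (auto simp: T_def)
  then show ?thesis
    using majorizes_imp_convex_hull[OF assms(3)] assms(4) by (auto simp: T_def)
qed

lemma convex_bound_of_majorizes:
  assumes "symmetric_fun f" "convex_on UNIV f" "majorizes (u *\<^sub>R a + v *\<^sub>R b) c"
    and "0 < u" "0 < v" "u + v = 1"
  shows "f c \<le> u * f a + v * f b"
proof -
  have "f c \<le> f (u *\<^sub>R a + v *\<^sub>R b)"
    by (rule symmetric_convex_majorizes[OF assms(1-3)])
  also have "\<dots> \<le> u * f a + v * f b"
    using assms(2,4-6) by (simp add: convex_on_def)
  finally show ?thesis .
qed

text \<open>Strictness has two sources: if \<open>a \<noteq> b\<close> it comes from \<open>f\<close> on the segment between \<open>a\<close> and \<open>b\<close>,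
  and if \<open>a = b\<close> from \<open>c\<close> being a genuine average of rearrangements of \<open>a\<close>.\<close>

lemma strictly_convex_bound_of_majorizes:
  assumes f: "symmetric_fun f" and sc: "strictly_convex_on UNIV f"
    and maj: "majorizes (u *\<^sub>R a + v *\<^sub>R b) c" and uv: "0 < u" "0 < v" "u + v = 1"
    and eq: "a = b \<Longrightarrow> c \<notin> rearrangements a"
  shows "f c < u * f a + v * f b"
proof (cases "a = b")
  case True
  then have ab: "u *\<^sub>R a + v *\<^sub>R b = a" "u * f a + v * f b = f a"
    using uv by (simp_all flip: scaleR_add_left distrib_right)
  show ?thesis
    using symmetric_strictly_convex_majorizes[OF f sc maj] eq[OF True] by (simp add: ab)
next
  case False
  define x where "x = u *\<^sub>R a + v *\<^sub>R b"
  have "f x < u * f a + v * f b"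
    using sc uv False by (simp add: strictly_convex_on_def x_def)
  moreover have "f c \<le> f x"
    using symmetric_strictly_convex_majorizes[OF f sc maj] symmetric_fun_rearrangements[OF f]
    unfolding x_def by (metis less_imp_le order.refl)
  ultimately show ?thesis by simp
qed

section \<open>Eigenvalues of a combination of symmetric matrices\<close>

text \<open>The partial trace is \<open>\<Sum>\<^sub>j a\<^sub>j w\<^sub>j\<close> with weights in \<open>[0, 1]\<close> of total weight \<open>card K\<close>, and such a sum is
  largest when the whole weight sits on the largest entries of \<open>a\<close>. Subtracting the last of these
  entries, \<open>a\<^sub>m\<close>, makes the comparison hold term by term.\<close>

lemma partial_diagonal_sum_le:
  fixes U :: "real ^ 'n::{finite,linorder} ^ 'n::{finite,linorder}"
  assumes U: "orthogonal_matrix U" and a: "decreasing a" and K: "card K = card {..m}"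
  shows "(\<Sum>i\<in>K. conj_diag U a $ i $ i) \<le> (\<Sum>i\<in>{..m}. a $ i)"
proof -
  define w where "w j = (\<Sum>i\<in>K. (U $ i $ j)\<^sup>2)" for j
  have w: "0 \<le> w j" "w j \<le> 1" for j
    unfolding w_def orthogonal_column_squares[OF U, of j, symmetric]
    by (auto intro: sum_nonneg sum_mono2)
  have "(\<Sum>j\<in>UNIV. w j) = (\<Sum>i\<in>K. \<Sum>j\<in>UNIV. (U $ i $ j)\<^sup>2)"
    unfolding w_def by (rule sum.swap)
  then have sum_w: "(\<Sum>j\<in>UNIV. w j) = real (card {..m})"
    by (simp add: orthogonal_row_squares[OF U] K)
  have "(\<Sum>i\<in>K. conj_diag U a $ i $ i) = (\<Sum>j\<in>UNIV. a $ j * w j)"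
    unfolding conj_diag_nth w_def sum_distrib_left
    by (subst sum.swap) (simp add: power2_eq_square mult_ac)
  also have "\<dots> = a $ m * real (card {..m}) + (\<Sum>j\<in>UNIV. (a $ j - a $ m) * w j)"
    by (simp add: left_diff_distrib sum_subtractf sum_w flip: sum_distrib_left)
  also have "(\<Sum>j\<in>UNIV. (a $ j - a $ m) * w j) \<le> (\<Sum>j\<in>UNIV. if j \<in> {..m} then a $ j - a $ m else 0)"
  proof (rule sum_mono)
    fix j
    show "(a $ j - a $ m) * w j \<le> (if j \<in> {..m} then a $ j - a $ m else 0)"
    proof (cases "j \<le> m")
      case True
      then have "0 \<le> a $ j - a $ m"
        using a by (simp add: decreasing_def)
      then show ?thesis
        using True w(2)[of j] by (simp add: mult_left_le)
    next
      case False
      then have "a $ j - a $ m \<le> 0"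
        using a by (simp add: decreasing_def)
      then show ?thesis
        using False w(1)[of j] by (simp add: mult_nonpos_nonneg)
    qed
  qed
  also have "\<dots> = (\<Sum>j\<in>{..m}. a $ j - a $ m)"
    by (simp only: sum.inter_restrict[OF finite, symmetric] Int_UNIV_left)
  also have "a $ m * real (card {..m}) + \<dots> = (\<Sum>i\<in>{..m}. a $ i)"
    by (simp add: sum_subtractf)
  finally show ?thesis by simp
qed

lemma inner_conj_diag_self:
  fixes H :: "real ^ 'n ^ 'n"
  assumes H: "orthogonal_matrix H"
  shows "conj_diag H d \<bullet> conj_diag H d = (\<Sum>i\<in>UNIV. (d $ i)\<^sup>2)"
proof -
  define M where "M = conj_diag H d"
  have "M $ i $ j = M $ j $ i" for i j
    by (simp add: M_def conj_diag_nth mult_ac)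
  then have "M \<bullet> M = (\<Sum>i\<in>UNIV. (M ** M) $ i $ i)"
    by (simp add: inner_vec_def matrix_matrix_mult_def)
  then show ?thesis
    by (simp add: M_def conj_diag_mult[OF H] trace_orthogonal_conj_diag[OF H] power2_eq_square)
qed

text \<open>The last conclusion records that equality in the majorization forces \<open>A = B\<close>: if \<open>A\<close>, \<open>B\<close> and their
  combination had the same spectrum they would have the same Frobenius norm, whose square is
  strictly convex.\<close>

lemma linear_combination_spectrum:
  fixes A B :: "real ^ 'n::{finite,linorder} ^ 'n::{finite,linorder}"
  assumes A: "A \<in> sym_matrices" and B: "B \<in> sym_matrices" and uv: "0 < u" "0 < v" "u + v = 1"
  obtains G a G' b H c where
    "orthogonal_matrix G" "A = conj_diag G a" "orthogonal_matrix G'" "B = conj_diag G' b"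
    "orthogonal_matrix H" "u *\<^sub>R A + v *\<^sub>R B = conj_diag H c"
    "majorizes (u *\<^sub>R a + v *\<^sub>R b) c" "A \<noteq> B \<Longrightarrow> a = b \<Longrightarrow> c \<notin> rearrangements a"
proof -
  obtain G a where G: "orthogonal_matrix G" "A = conj_diag G a" "decreasing a"
    using A spectral_theorem_decreasing by (auto simp: sym_matrices_def)
  obtain G' b where G': "orthogonal_matrix G'" "B = conj_diag G' b" "decreasing b"
    using B spectral_theorem_decreasing by (auto simp: sym_matrices_def)
  have "transpose (u *\<^sub>R A + v *\<^sub>R B) = u *\<^sub>R A + v *\<^sub>R B"
    using A B by (simp add: sym_matrices_def transpose_def vec_eq_iff)
  then obtain H c where H: "orthogonal_matrix H" "u *\<^sub>R A + v *\<^sub>R B = conj_diag H c"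
    using spectral_theorem by blast
  define U U' where "U = transpose H ** G" and "U' = transpose H ** G'"
  have U: "orthogonal_matrix U" "orthogonal_matrix U'"
    using G(1) G'(1) H(1) by (simp_all add: U_def U'_def orthogonal_matrix_mul)
  have "conj_diag (transpose H ** H) c = transpose H ** (u *\<^sub>R A + v *\<^sub>R B) ** H"
    using conj_diag_congruence[of "transpose H" H c] by (simp add: H(2))
  also have "\<dots> = u *\<^sub>R conj_diag U a + v *\<^sub>R conj_diag U' b"
    using conj_diag_congruence[of "transpose H" G a] conj_diag_congruence[of "transpose H" G' b]
    by (simp add: matrix_ring_simps G(2) G'(2) U_def U'_def)
  finally have c: "diag_matrix c = u *\<^sub>R conj_diag U a + v *\<^sub>R conj_diag U' b"
    by (simp add: orthogonal_matrix_cancel(1)[OF H(1)])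
  have c_nth: "c $ i = u * conj_diag U a $ i $ i + v * conj_diag U' b $ i $ i" for i
    using arg_cong[OF c, of "\<lambda>M. M $ i $ i"] by (simp add: diag_matrix_nth)
  have "majorizes (u *\<^sub>R a + v *\<^sub>R b) c"
    unfolding majorizes_def
  proof (intro conjI allI impI)
    fix m :: 'n and K :: "'n set" assume K: "card K = card {..m}"
    show "(\<Sum>i\<in>K. c $ i) \<le> (\<Sum>i\<in>{..m}. (u *\<^sub>R a + v *\<^sub>R b) $ i)"
      using partial_diagonal_sum_le[OF U(1) G(3) K] partial_diagonal_sum_le[OF U(2) G'(3) K] uv
      by (simp add: c_nth sum.distrib add_mono mult_left_mono flip: sum_distrib_left)
  next
    show "(\<Sum>i\<in>UNIV. c $ i) = (\<Sum>i\<in>UNIV. (u *\<^sub>R a + v *\<^sub>R b) $ i)"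
      by (simp add: c_nth sum.distrib trace_orthogonal_conj_diag[OF U(1)]
          trace_orthogonal_conj_diag[OF U(2)] flip: sum_distrib_left)
  qed
  moreover have "c \<notin> rearrangements a" if "A \<noteq> B" "a = b"
  proof
    assume "c \<in> rearrangements a"
    define N where "N = (\<Sum>i\<in>UNIV. (a $ i)\<^sup>2)"
    \<comment> \<open>The identity \<open>uv |A - B|\<^sup>2 = u |A|\<^sup>2 + v |B|\<^sup>2 - |uA + vB|\<^sup>2\<close> for \<open>u + v = 1\<close>.\<close>
    have "A \<bullet> A = N" "B \<bullet> B = N" "(u *\<^sub>R A + v *\<^sub>R B) \<bullet> (u *\<^sub>R A + v *\<^sub>R B) = N"
      using G G' H that(2) rearrangements_sum[OF \<open>c \<in> rearrangements a\<close>, of "\<lambda>x. x\<^sup>2"]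
      by (simp_all add: N_def inner_conj_diag_self)
    moreover have "u * v * ((A - B) \<bullet> (A - B))
        = u * (u + v) * (A \<bullet> A) + v * (u + v) * (B \<bullet> B) - (u *\<^sub>R A + v *\<^sub>R B) \<bullet> (u *\<^sub>R A + v *\<^sub>R B)"
      by (simp add: inner_add_left inner_add_right inner_diff_left inner_diff_right inner_commute
          algebra_simps)
    ultimately have "u * v * ((A - B) \<bullet> (A - B)) = 0"
      using uv by (simp flip: distrib_right)
    then show False
      using uv that(1) by simp
  qed
  ultimately show ?thesis
    using that G G' H by blast
qed

section \<open>Inequalities for geometric means and determinants\<close>

text \<open>The tangent line of the exponential at \<open>t * d\<close> lies strictly below it at \<open>0\<close> and at \<open>d\<close>.\<close>

lemma exp_strict_convex_bound:
  fixes d t :: real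
  assumes "0 < t" "t < 1" "d \<noteq> 0"
  shows "exp (t * d) < (1 - t) + t * exp d"
proof -
  have gt: "1 + x < exp x" if "x \<noteq> 0" for x :: real
  proof -
    have "exp x \<noteq> 1 + x"
    proof
      assume "exp x = 1 + x"
      then have "ln (exp x) = exp x - 1"
        unfolding ln_exp by simp
      then have "exp x = 1"
        by (rule ln_eq_minus_one[OF exp_gt_zero])
      with that show False by simp
    qed
    then show ?thesis
      using exp_ge_add_one_self[of x] by linarith
  qed
  have "exp (t * d) = exp (t * d) * ((1 - t) * (1 + (- (t * d))) + t * (1 + (1 - t) * d))"
    by (simp add: algebra_simps)
  also have "\<dots> < exp (t * d) * ((1 - t) * exp (- (t * d)) + t * exp ((1 - t) * d))"
    using assms gt[of "- (t * d)"] gt[of "(1 - t) * d"]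
    by (intro mult_strict_left_mono add_strict_mono) auto
  also have "\<dots> = (1 - t) * exp (t * d + - (t * d)) + t * exp (t * d + (1 - t) * d)"
    by (simp only: exp_add) (simp add: algebra_simps)
  also have "\<dots> = (1 - t) + t * exp d"
    by (simp add: algebra_simps)
  finally show ?thesis .
qed

text \<open>After division by the right-hand side, both terms on the left are bounded by
  weighted arithmetic means whose sum is \<open>1\<close>. Iterated, this is Hoelder's inequality.\<close>

lemma weighted_geometric_mean_superadditive:
  fixes p q r s t :: real
  assumes "0 \<le> p" "0 \<le> q" "0 \<le> r" "0 \<le> s" and t: "0 < t" "t < 1"
  shows "p powr (1 - t) * q powr t + r powr (1 - t) * s powr t \<le> (p + r) powr (1 - t) * (q + s) powr t"
proof (cases "p + r = 0 \<or> q + s = 0")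
  case True
  then have "p = 0 \<and> r = 0 \<or> q = 0 \<and> s = 0"
    using assms by auto
  then show ?thesis by auto
next
  case False
  then have pos: "0 < p + r" "0 < q + s"
    using assms by linarith+
  have young: "u powr (1 - t) * v powr t \<le> (1 - t) * u + t * v" if "0 \<le> u" "0 \<le> v" for u v
  proof (cases "u = 0 \<or> v = 0")
    case False
    then show ?thesis
      using that t by (intro Youngs_inequality_0) auto
  qed (use that t in auto)
  have bound: "x powr (1 - t) * y powr t
      \<le> ((1 - t) * (x / (p + r)) + t * (y / (q + s))) * ((p + r) powr (1 - t) * (q + s) powr t)"
    if "0 \<le> x" "0 \<le> y" for x y
  proof -
    have "x powr (1 - t) * y powr t
        = (x / (p + r)) powr (1 - t) * (y / (q + s)) powr t * ((p + r) powr (1 - t) * (q + s) powr t)"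
      using that pos by (simp add: powr_divide)
    also have "\<dots> \<le> ((1 - t) * (x / (p + r)) + t * (y / (q + s)))
        * ((p + r) powr (1 - t) * (q + s) powr t)"
      using that pos by (intro mult_right_mono young) auto
    finally show ?thesis .
  qed
  define W where "W = (p + r) powr (1 - t) * (q + s) powr t"
  have "((1 - t) * (p / (p + r)) + t * (q / (q + s))) + ((1 - t) * (r / (p + r)) + t * (s / (q + s)))
      = (1 - t) * ((p + r) / (p + r)) + t * ((q + s) / (q + s))"
    by (simp only: add_divide_distrib distrib_left ac_simps)
  also have "\<dots> = 1"
    using pos by simp
  finally have one: "((1 - t) * (p / (p + r)) + t * (q / (q + s)))
      + ((1 - t) * (r / (p + r)) + t * (s / (q + s))) = 1" .
  have "p powr (1 - t) * q powr t + r powr (1 - t) * s powr t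
      \<le> ((1 - t) * (p / (p + r)) + t * (q / (q + s))) * W
        + ((1 - t) * (r / (p + r)) + t * (s / (q + s))) * W"
    unfolding W_def by (intro add_mono bound assms)
  also have "\<dots> = W"
    unfolding distrib_right[symmetric] one by simp
  finally show ?thesis
    by (simp add: W_def)
qed

lemma weighted_geometric_mean_sum:
  fixes p q :: "'a \<Rightarrow> real"
  assumes "finite S" "\<And>i. i \<in> S \<Longrightarrow> 0 \<le> p i" "\<And>i. i \<in> S \<Longrightarrow> 0 \<le> q i" "0 < t" "t < 1"
  shows "(\<Sum>i\<in>S. p i powr (1 - t) * q i powr t) \<le> (\<Sum>i\<in>S. p i) powr (1 - t) * (\<Sum>i\<in>S. q i) powr t"
  using assms
proof (induction S rule: finite_induct)
  case (insert x S)
  have "(\<Sum>i\<in>insert x S. p i powr (1 - t) * q i powr t)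
      \<le> p x powr (1 - t) * q x powr t + (\<Sum>i\<in>S. p i) powr (1 - t) * (\<Sum>i\<in>S. q i) powr t"
    using insert by simp
  also have "\<dots> \<le> (p x + (\<Sum>i\<in>S. p i)) powr (1 - t) * (q x + (\<Sum>i\<in>S. q i)) powr t"
    using insert by (intro weighted_geometric_mean_superadditive sum_nonneg) auto
  finally show ?case
    using insert by simp
qed simp

text \<open>Jensen's inequality: the squares of a row of an orthogonal matrix are weights of total mass \<open>1\<close>.\<close>

lemma exp_le_diagonal_conj_diag:
  fixes H :: "real ^ 'n ^ 'n"
  assumes H: "orthogonal_matrix H"
  shows "exp (\<Sum>k\<in>UNIV. (H $ i $ k)\<^sup>2 * m $ k) \<le> conj_diag H (vmap exp m) $ i $ i"
  using convex_on_sum[OF _ _ exp_convex, of UNIV "\<lambda>k. (H $ i $ k)\<^sup>2" "\<lambda>k. m $ k"]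
    orthogonal_row_squares[OF H]
  by (simp add: conj_diag_nth power2_eq_square mult_ac)

text \<open>Multiply the Jensen bounds of all diagonal entries: the exponents add up to the sum of the logarithms
  of the eigenvalues because the columns of squares also have total mass \<open>1\<close>.\<close>

lemma hadamard_inequality:
  fixes M :: "real ^ 'n ^ 'n"
  assumes "pos_def M"
  shows "det M \<le> (\<Prod>i\<in>UNIV. M $ i $ i)"
proof -
  obtain H m where H: "orthogonal_matrix H" and M: "M = conj_diag H (vmap exp m)"
    using pos_def_spectral_exp[OF assms] .
  have "det M = exp (\<Sum>k\<in>UNIV. m $ k)"
    by (simp add: M det_conj_diag det_orthogonal_power2[OF H] exp_sum)
  also have "(\<Sum>k\<in>UNIV. m $ k) = (\<Sum>k\<in>UNIV. (\<Sum>i\<in>UNIV. (H $ i $ k)\<^sup>2) * m $ k)"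
    by (simp add: orthogonal_column_squares[OF H])
  also have "\<dots> = (\<Sum>i\<in>UNIV. \<Sum>k\<in>UNIV. (H $ i $ k)\<^sup>2 * m $ k)"
    unfolding sum_distrib_right by (rule sum.swap)
  also have "exp \<dots> = (\<Prod>i\<in>UNIV. exp (\<Sum>k\<in>UNIV. (H $ i $ k)\<^sup>2 * m $ k))"
    by (simp add: exp_sum)
  also have "\<dots> \<le> (\<Prod>i\<in>UNIV. M $ i $ i)"
    unfolding M by (intro prod_mono conjI exp_le_diagonal_conj_diag H) simp
  finally show ?thesis .
qed

lemma matrix_nth_inner:
  fixes M :: "real ^ 'n ^ 'n"
  shows "M $ i $ j = axis i 1 \<bullet> (M *v axis j 1)"
  by (simp add: inner_axis' matrix_vector_mult_basis column_def)

text \<open>Change coordinates so that \<open>A\<close> becomes the identity and \<open>B\<close> diagonal. The hypothesis on the coordinate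
  vectors bounds the diagonal of the transformed \<open>C\<close>, and Hadamard's inequality bounds its determinant
  by the product of the diagonal.\<close>

lemma det_le_of_form_le_geometric_mean:
  fixes A B C :: "real ^ 'n ^ 'n"
  assumes A: "pos_def A" and B: "pos_def B" and C: "pos_def C"
    and form: "\<And>z. z \<bullet> (C *v z) \<le> (z \<bullet> (A *v z)) powr (1 - t) * (z \<bullet> (B *v z)) powr t"
  shows "det C \<le> det A powr (1 - t) * det B powr t"
proof -
  obtain L d where L: "det L \<noteq> 0" and A': "A = conj_diag L 1" and B': "B = conj_diag L (vmap exp d)"
    using geodesic_representation[OF A B] by metis
  obtain S where S: "S ** L = mat 1" "L ** S = mat 1"
    using L by (auto simp: invertible_def simp flip: invertible_det_nz)
  \<comment> \<open>\<open>S\<close> is the inverse of \<open>L\<close>, so \<open>M\<close> is the form \<open>C\<close> in the basis diagonalising \<open>A\<close> and \<open>B\<close>.\<close>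
  define M where "M = S ** C ** transpose S"
  have "det S * det L = 1"
    by (metis S(1) det_I det_mul)
  then have "det S \<noteq> 0" by auto
  then have "pos_def M"
    unfolding M_def by (intro pos_def_congruence C)
  then have "det M \<le> (\<Prod>i\<in>UNIV. M $ i $ i)"
    by (rule hadamard_inequality)
  also have "\<dots> \<le> (\<Prod>i\<in>UNIV. exp (t * d $ i))"
  proof (intro prod_mono conjI)
    fix i
    define w where "w = axis i 1 v* S"
    have wL: "w v* L = axis i 1"
      by (simp add: w_def vector_matrix_mul_assoc S(1))
    have M_ii: "M $ i $ i = w \<bullet> (C *v w)"
      by (simp add: matrix_nth_inner M_def w_def dot_lmul_matrix flip: matrix_vector_mul_assoc)
    have "w \<noteq> 0"
      by (metis wL axis_eq_0_iff vector_matrix_mult_0 zero_neq_one)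
    then show "0 \<le> M $ i $ i"
      using C by (auto simp: M_ii pos_def_def less_imp_le)
    have "w \<bullet> (A *v w) = 1" "w \<bullet> (B *v w) = exp (d $ i)"
      by (simp_all add: A' B' inner_conj_diag wL axis_def if_distrib if_distribR cong: if_cong)
    then show "M $ i $ i \<le> exp (t * d $ i)"
      using form[of w] by (simp add: M_ii exp_powr_real mult.commute)
  qed
  finally have M: "det M \<le> exp (t * (\<Sum>i\<in>UNIV. d $ i))"
    by (simp add: exp_sum sum_distrib_left)
  have "L ** M ** transpose L = (L ** S) ** C ** transpose (L ** S)"
    by (simp add: M_def matrix_transpose_mul matrix_mul_assoc)
  then have "C = L ** M ** transpose L"
    by (simp add: S(2))
  then have "det C = (det L)\<^sup>2 * det M"
    by (simp add: det_mul power2_eq_square)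
  also have "\<dots> \<le> (det L)\<^sup>2 * exp (t * (\<Sum>i\<in>UNIV. d $ i))"
    by (intro mult_left_mono M) simp
  also have "\<dots> = det A powr (1 - t) * det B powr t"
  proof -
    have "(det L)\<^sup>2 powr (1 - t) * (det L)\<^sup>2 powr t = (det L)\<^sup>2"
      using L by (simp flip: powr_add)
    then show ?thesis
      by (simp add: A' B' det_conj_diag exp_sum[symmetric] powr_mult exp_powr_real mult.commute)
  qed
  finally show ?thesis .
qed

section \<open>Principal minors\<close>

text \<open>Padding with the identity outside \<open>K\<close> keeps the matrix in the same type, and its determinant
  is the principal minor of \<open>M\<close> on \<open>K\<close>.\<close>

definition principal_block :: "'n set \<Rightarrow> real ^ 'n ^ 'n \<Rightarrow> real ^ 'n ^ 'n" where
  "principal_block K M =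
     (\<chi> i j. if i \<in> K \<and> j \<in> K then M $ i $ j else if i = j then 1 else 0)"

definition restrict_vec :: "'n set \<Rightarrow> real ^ 'n \<Rightarrow> real ^ 'n" where
  "restrict_vec K z = (\<chi> i. if i \<in> K then z $ i else 0)"

lemma inner_matrix_vector:
  "z \<bullet> (M *v z) = (\<Sum>i\<in>UNIV. \<Sum>j\<in>UNIV. z $ i * M $ i $ j * (z::real ^ 'n) $ j)"
  by (simp add: inner_vec_def matrix_vector_mult_def sum_distrib_left mult_ac)

lemma inner_principal_block:
  "z \<bullet> (principal_block K M *v z)
     = restrict_vec K z \<bullet> (M *v restrict_vec K z) + (\<Sum>i\<in>-K. (z $ i)\<^sup>2)"
proof -
  have "z $ i * principal_block K M $ i $ j * z $ j
      = restrict_vec K z $ i * M $ i $ j * restrict_vec K z $ j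
        + (if i = j then if i \<in> -K then (z $ i)\<^sup>2 else 0 else 0)" for i j
    by (simp add: principal_block_def restrict_vec_def power2_eq_square)
  then have "z \<bullet> (principal_block K M *v z) = restrict_vec K z \<bullet> (M *v restrict_vec K z)
      + (\<Sum>i\<in>UNIV. if i \<in> -K then (z $ i)\<^sup>2 else 0)"
    by (simp add: inner_matrix_vector sum.distrib)
  moreover have "{i. i \<notin> K} = -K"
    by auto
  ultimately show ?thesis
    by (simp add: sum.If_cases)
qed

lemma pos_def_principal_block:
  assumes "pos_def M"
  shows "pos_def (principal_block K M)"
proof -
  have "M $ i $ j = M $ j $ i" for i j
    using assms by (simp add: pos_def_def transpose_def vec_eq_iff)
  then have "transpose (principal_block K M) = principal_block K M"
    by (auto simp: principal_block_def transpose_def vec_eq_iff)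
  moreover have "0 < z \<bullet> (principal_block K M *v z)" if "z \<noteq> 0" for z
  proof (cases "restrict_vec K z = 0")
    case True
    obtain i where "z $ i \<noteq> 0"
      using \<open>z \<noteq> 0\<close> by (auto simp: vec_eq_iff)
    moreover have "restrict_vec K z $ i = 0"
      using True by simp
    ultimately have "z $ i \<noteq> 0" "i \<in> -K"
      by (auto simp: restrict_vec_def split: if_splits)
    then show ?thesis
      unfolding inner_principal_block True by (simp add: sum_pos2[of "-K" i])
  next
    case False
    then have "0 < restrict_vec K z \<bullet> (M *v restrict_vec K z)"
      using assms by (auto simp: pos_def_def)
    then show ?thesis
      by (simp add: inner_principal_block add_pos_nonneg sum_nonneg)
  qed
  ultimately show ?thesis
    by (simp add: pos_def_def)
qed

definition coord_proj :: "'n set \<Rightarrow> real ^ 'n ^ 'n" where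
  "coord_proj K = diag_matrix (\<chi> i. if i \<in> K then 1 else 0)"

lemma coord_proj_simps:
  fixes X :: "real ^ 'n ^ 'n"
  shows "coord_proj K ** coord_proj K = coord_proj K"
    "coord_proj (-K) ** coord_proj (-K) = coord_proj (-K)"
    "coord_proj K ** coord_proj (-K) = 0" "coord_proj (-K) ** coord_proj K = 0"
    "coord_proj K + coord_proj (-K) = mat 1"
    "X ** coord_proj K ** coord_proj K = X ** coord_proj K"
    "X ** coord_proj (-K) ** coord_proj (-K) = X ** coord_proj (-K)"
    "X ** coord_proj K ** coord_proj (-K) = 0" "X ** coord_proj (-K) ** coord_proj K = 0"
  by (simp_all add: coord_proj_def vec_eq_iff diag_matrix_left_nth diag_matrix_right_nth
      diag_matrix_nth mat_def)

lemma coord_proj_sandwich: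
  "(coord_proj K ** M ** coord_proj K) $ i $ j = (if i \<in> K \<and> j \<in> K then M $ i $ j else 0)"
  by (simp add: coord_proj_def diag_matrix_left_nth diag_matrix_right_nth)

lemma principal_block_eq:
  "principal_block K M = coord_proj K ** M ** coord_proj K + coord_proj (-K)"
  by (auto simp: vec_eq_iff principal_block_def coord_proj_sandwich)
    (auto simp: coord_proj_def diag_matrix_nth)

text \<open>The off-diagonal block \<open>N\<close> squares to zero and is conjugate to \<open>- N\<close> by the reflection \<open>J\<close>. So
  \<open>1 + N\<close> and its inverse \<open>1 - N\<close> have equal determinants, which makes the determinant \<open>\<plusminus>1\<close>, and
  \<open>1 + N = (1 + N/2)\<^sup>2\<close> makes it nonnegative.\<close>

lemma det_unipotent_offdiagonal:
  fixes M :: "real ^ 'n ^ 'n"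
  shows "det (mat 1 + coord_proj (-K) ** M ** coord_proj K) = 1"
proof -
  define P Q N J where "P = (coord_proj K :: real ^ 'n ^ 'n)"
    and "Q = (coord_proj (-K) :: real ^ 'n ^ 'n)" and "N = Q ** M ** P" and "J = P - Q"
  note PQ = coord_proj_simps[where K = K, folded P_def Q_def]
  have NN: "N ** N = 0"
    by (simp add: N_def matrix_mul_assoc PQ)
  have JJ: "J ** J = mat 1"
    using PQ by (simp add: J_def matrix_ring_simps)
  have JNJ: "J ** N ** J = - N"
    by (simp add: J_def N_def matrix_ring_simps matrix_mul_assoc PQ)
  have "J ** (mat 1 + N) ** J = mat 1 - N"
    by (simp add: matrix_ring_simps JJ JNJ)
  then have "det (mat 1 - N) = det J * det (mat 1 + N) * det J"
    by (simp flip: det_mul)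
  also have "\<dots> = det (J ** J) * det (mat 1 + N)"
    by (simp add: det_mul)
  finally have "det (mat 1 - N) = det (mat 1 + N)"
    by (simp add: JJ)
  moreover have "(mat 1 + N) ** (mat 1 - N) = mat 1"
    by (simp add: matrix_ring_simps NN)
  then have "det (mat 1 + N) * det (mat 1 - N) = 1"
    by (simp flip: det_mul)
  ultimately have "(det (mat 1 + N))\<^sup>2 = 1"
    by (simp add: power2_eq_square)
  moreover have "(mat 1 + (1/2) *\<^sub>R N) ** (mat 1 + (1/2) *\<^sub>R N) = mat 1 + N"
    using NN by (simp add: matrix_ring_simps flip: scaleR_add_left)
  then have "det (mat 1 + N) = det (mat 1 + (1/2) *\<^sub>R N) * det (mat 1 + (1/2) *\<^sub>R N)"
    by (simp flip: det_mul)
  then have "0 \<le> det (mat 1 + N)"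
    by simp
  ultimately show ?thesis
    by (simp add: N_def P_def Q_def power2_eq_1_iff)
qed

text \<open>Block elimination: the columns in \<open>K\<close> of \<open>M\<close> completed by unit columns differ from the padded block
  by a unipotent right factor.\<close>

lemma det_principal_block_columns:
  fixes M :: "real ^ 'n ^ 'n"
  shows "det (M ** coord_proj K + coord_proj (-K)) = det (principal_block K M)"
proof -
  define P Q where "P = (coord_proj K :: real ^ 'n ^ 'n)" and "Q = (coord_proj (-K) :: real ^ 'n ^ 'n)"
  note PQ = coord_proj_simps[where K = K, folded P_def Q_def]
  have "principal_block K M ** (mat 1 + Q ** M ** P) = P ** M ** P + Q ** M ** P + Q"
    by (simp add: principal_block_eq P_def[symmetric] Q_def[symmetric] matrix_ring_simps
        matrix_mul_assoc PQ)
  also have "\<dots> = M ** P + Q"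
    by (simp add: PQ(5) flip: matrix_ring_simps(1))
  finally have "det (principal_block K M) * det (mat 1 + Q ** M ** P) = det (M ** P + Q)"
    by (simp flip: det_mul)
  then show ?thesis
    using det_unipotent_offdiagonal[of K M] by (simp add: P_def Q_def)
qed

text \<open>Jacobi's identity: complementary minors of a matrix and its inverse agree up to the determinant.\<close>

lemma jacobi_complementary_block:
  fixes X Y :: "real ^ 'n ^ 'n"
  assumes "Y ** X = mat 1"
  shows "det Y * det (principal_block K X) = det (principal_block (-K) Y)"
proof -
  have "Y ** (X ** coord_proj K + coord_proj (-K)) = Y ** coord_proj (-K) + coord_proj (- (-K))"
    using assms by (simp add: matrix_ring_simps matrix_mul_assoc add.commute)
  then have "det Y * det (X ** coord_proj K + coord_proj (-K))
      = det (Y ** coord_proj (-K) + coord_proj (- (-K)))"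
    by (simp flip: det_mul)
  then show ?thesis
    by (simp only: det_principal_block_columns)
qed

text \<open>When all eigenvalues of \<open>X\<close> are at least \<open>1\<close>, passing to a principal block does not increase the determinant. By
  Jacobi's identity the quotient is the complementary minor of the inverse, whose diagonal entries are
  at most \<open>1\<close>, so Hadamard's inequality applies to it.\<close>

lemma det_principal_block_le:
  fixes G :: "real ^ 'n ^ 'n"
  assumes G: "orthogonal_matrix G" and x: "\<And>i. 0 \<le> x $ i"
  shows "det (principal_block K (conj_diag G (vmap exp x))) \<le> exp (\<Sum>i\<in>UNIV. x $ i)"
proof -
  define X Y where "X = conj_diag G (vmap exp x)" and "Y = conj_diag G (vmap exp (- x))"
  have "Y ** X = mat 1"
    unfolding X_def Y_def conj_diag_mult[OF G] conj_diag_one[OF G, symmetric]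
    by (intro arg_cong[of _ _ "conj_diag G"]) (simp add: vec_eq_iff flip: exp_add)
  then have "det Y * det (principal_block K X) = det (principal_block (-K) Y)"
    by (rule jacobi_complementary_block)
  also have "\<dots> \<le> (\<Prod>i\<in>UNIV. principal_block (-K) Y $ i $ i)"
    unfolding Y_def by (intro hadamard_inequality pos_def_principal_block pos_def_conj_diag_exp G)
  also have "\<dots> \<le> 1"
  proof (intro prod_le_1 conjI)
    fix i
    have "Y $ i $ i = (\<Sum>k\<in>UNIV. exp (- x $ k) * (G $ i $ k)\<^sup>2)"
      by (simp add: Y_def conj_diag_nth power2_eq_square mult_ac)
    moreover have "\<dots> \<le> (\<Sum>k\<in>UNIV. 1 * (G $ i $ k)\<^sup>2)"
      using x by (intro sum_mono mult_right_mono) auto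
    moreover have "0 \<le> (\<Sum>k\<in>UNIV. exp (- x $ k) * (G $ i $ k)\<^sup>2)"
      by (intro sum_nonneg) auto
    ultimately show "principal_block (-K) Y $ i $ i \<le> 1" "0 \<le> principal_block (-K) Y $ i $ i"
      using orthogonal_row_squares[OF G, of i] by (auto simp: principal_block_def)
  qed
  finally have "det Y * det (principal_block K X) \<le> 1" .
  moreover have "det Y = inverse (exp (\<Sum>i\<in>UNIV. x $ i))"
    by (simp add: Y_def det_conj_diag det_orthogonal_power2[OF G] exp_sum exp_minus prod_inversef[symmetric])
  ultimately show ?thesis
    by (simp add: X_def field_simps)
qed

section \<open>Eigenvalues along a geodesic\<close>

text \<open>In the coordinates \<open>y = L\<^sup>T z\<close> the three forms are \<open>\<Sum> exp(t d\<^sub>k) y\<^sub>k\<^sup>2\<close> at the respective parameters, and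
  the inequality is Hoelder's.\<close>

lemma conj_diag_form_geometric_mean:
  fixes L :: "real ^ 'n ^ 'n"
  assumes "0 < t" "t < 1"
  shows "z \<bullet> (conj_diag L (vmap exp (t *\<^sub>R d)) *v z)
    \<le> (z \<bullet> (conj_diag L 1 *v z)) powr (1 - t) * (z \<bullet> (conj_diag L (vmap exp d) *v z)) powr t"
proof -
  have "exp (t * d $ k) * y\<^sup>2 = (y\<^sup>2) powr (1 - t) * (exp (d $ k) * y\<^sup>2) powr t" for k and y :: real
  proof -
    have "(y\<^sup>2) powr (1 - t) * (y\<^sup>2) powr t = y\<^sup>2"
      by (cases "y = 0") (simp_all flip: powr_add)
    then show ?thesis
      by (simp add: powr_mult exp_powr_real mult.commute mult.left_commute)
  qed
  then show ?thesis
    using weighted_geometric_mean_sum[of UNIV "\<lambda>k. ((z v* L) $ k)\<^sup>2" "\<lambda>k. exp (d $ k) * ((z v* L) $ k)\<^sup>2" t]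
      assms by (simp add: inner_conj_diag)
qed

text \<open>The sum over \<open>K\<close> of \<open>c - \<gamma>\<close> is the logarithm of a principal minor. Divide \<open>A\<close> and \<open>B\<close> by
  their eigenvalues of index \<open>m\<close>, and raise to \<open>1\<close> every eigenvalue that is now smaller. This only
  enlarges the outer forms, so the geometric mean bound survives, also for the
  principal blocks on \<open>K\<close>; and now the minors of the outer matrices are at most their determinants,
  in which only the eigenvalues up to index \<open>m\<close> contribute. Since \<open>K\<close> has as many elements
  as this initial segment, the normalisations cancel in the end.\<close>

lemma log_eigenvalue_partial_sums:
  fixes G G' :: "real ^ 'n::{finite,linorder} ^ 'n::{finite,linorder}"
  assumes G: "orthogonal_matrix G" and a: "decreasing a" and G': "orthogonal_matrix G'"
    and b: "decreasing b" and t: "0 < t" "t < 1"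
    and form: "\<And>z. z \<bullet> (diag_matrix (vmap exp c) *v z)
      \<le> (z \<bullet> (conj_diag G (vmap exp a) *v z)) powr (1 - t)
        * (z \<bullet> (conj_diag G' (vmap exp b) *v z)) powr t"
    and K: "card K = card {..m}"
  shows "(\<Sum>i\<in>K. c $ i) \<le> (\<Sum>i\<in>{..m}. ((1 - t) *\<^sub>R a + t *\<^sub>R b) $ i)"
proof -
  define \<gamma> where "\<gamma> = (1 - t) * a $ m + t * b $ m"
  define trunc where "trunc x = vmap (\<lambda>y. max (y - x $ m) 0) x" for x :: "real ^ 'n::{finite,linorder}"
  define A B C where "A = conj_diag G (vmap exp (trunc a))"
    and "B = conj_diag G' (vmap exp (trunc b))"
    and "C = diag_matrix (vmap exp (vmap (\<lambda>y. y - \<gamma>) c))"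
  have "pos_def C"
    using pos_def_conj_diag_exp[OF orthogonal_matrix_id] by (simp add: C_def)
  have A: "pos_def A" and B: "pos_def B"
    using G G' by (simp_all add: A_def B_def pos_def_conj_diag_exp)
  have trunc_le: "exp (- x $ m) * (z \<bullet> (conj_diag U (vmap exp x) *v z))
      \<le> z \<bullet> (conj_diag U (vmap exp (trunc x)) *v z)" for U x and z :: "real ^ 'n::{finite,linorder}"
    unfolding inner_conj_diag sum_distrib_left
  proof (rule sum_mono)
    fix k
    have "exp (- x $ m) * exp (x $ k) \<le> exp (trunc x $ k)"
      by (simp add: trunc_def flip: exp_add)
    then show "exp (- x $ m) * (vmap exp x $ k * ((z v* U) $ k)\<^sup>2)
        \<le> vmap exp (trunc x) $ k * ((z v* U) $ k)\<^sup>2"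
      using mult_right_mono[OF _ zero_le_power2] by (simp add: mult.assoc[symmetric])
  qed
  have C_form: "z \<bullet> (C *v z) \<le> (z \<bullet> (A *v z)) powr (1 - t) * (z \<bullet> (B *v z)) powr t" for z
  proof -
    have nonneg: "0 \<le> z \<bullet> (conj_diag U (vmap exp x) *v z)" for U and x :: "real ^ 'n::{finite,linorder}"
      by (simp add: inner_conj_diag sum_nonneg)
    have "z \<bullet> (C *v z) = exp (- \<gamma>) * (z \<bullet> (diag_matrix (vmap exp c) *v z))"
      unfolding C_def conj_diag_id[symmetric] inner_conj_diag sum_distrib_left
      by (simp add: exp_diff exp_minus field_simps)
    also have "\<dots> \<le> exp (- \<gamma>) * ((z \<bullet> (conj_diag G (vmap exp a) *v z)) powr (1 - t)
        * (z \<bullet> (conj_diag G' (vmap exp b) *v z)) powr t)"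
      by (intro mult_left_mono form) simp
    also have "\<dots> = (exp (- a $ m) * (z \<bullet> (conj_diag G (vmap exp a) *v z))) powr (1 - t)
        * (exp (- b $ m) * (z \<bullet> (conj_diag G' (vmap exp b) *v z))) powr t"
    proof -
      have "exp (- \<gamma>) = exp (- a $ m) powr (1 - t) * exp (- b $ m) powr t"
        by (simp add: exp_powr_real \<gamma>_def algebra_simps flip: exp_add)
      then show ?thesis
        using nonneg by (simp add: powr_mult)
    qed
    also have "\<dots> \<le> (z \<bullet> (A *v z)) powr (1 - t) * (z \<bullet> (B *v z)) powr t"
      unfolding A_def B_def using t nonneg
      by (intro mult_mono powr_mono2 trunc_le) auto
    finally show ?thesis .
  qed
  have "z \<bullet> (principal_block K C *v z)
      \<le> (z \<bullet> (principal_block K A *v z)) powr (1 - t) * (z \<bullet> (principal_block K B *v z)) powr t" for z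
  proof -
    define r s where "r = restrict_vec K z" and "s = (\<Sum>i\<in>-K. (z $ i)\<^sup>2)"
    have s: "0 \<le> s"
      by (simp add: s_def sum_nonneg)
    have nonneg: "0 \<le> r \<bullet> (A *v r)" "0 \<le> r \<bullet> (B *v r)"
      using A B by (cases "r = 0"; simp add: pos_def_def less_imp_le)+
    \<comment> \<open>On the padding all three blocks have the same form \<open>s\<close>, so superadditivity of the geometric
      mean absorbs it.\<close>
    have "s = s powr (1 - t) * s powr t"
      using s by (cases "s = 0") (simp_all flip: powr_add)
    then have "r \<bullet> (C *v r) + s
        \<le> (r \<bullet> (A *v r)) powr (1 - t) * (r \<bullet> (B *v r)) powr t + s powr (1 - t) * s powr t"
      using C_form[of r] by simp
    also have "\<dots> \<le> (r \<bullet> (A *v r) + s) powr (1 - t) * (r \<bullet> (B *v r) + s) powr t"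
      using nonneg s t by (intro weighted_geometric_mean_superadditive)
    finally show ?thesis
      by (simp add: inner_principal_block r_def s_def)
  qed
  then have "det (principal_block K C)
      \<le> det (principal_block K A) powr (1 - t) * det (principal_block K B) powr t"
    using A B \<open>pos_def C\<close>
    by (intro det_le_of_form_le_geometric_mean pos_def_principal_block)
  also have "\<dots> \<le> exp (\<Sum>i\<in>UNIV. trunc a $ i) powr (1 - t) * exp (\<Sum>i\<in>UNIV. trunc b $ i) powr t"
  proof -
    have "0 \<le> det (principal_block K M)" if "pos_def M" for M :: "real ^ 'n::{finite,linorder} ^ 'n::{finite,linorder}"
      using pos_def_spectral_exp[OF pos_def_principal_block[OF that], of K]
      by (metis det_conj_diag exp_ge_zero mult_nonneg_nonneg prod_nonneg vmap_nth zero_le_power2)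
    then show ?thesis
      using t A B unfolding A_def B_def
      by (intro mult_mono powr_mono2 det_principal_block_le G G') (auto simp: trunc_def)
  qed
  also have "\<dots> = exp ((1 - t) * (\<Sum>i\<in>UNIV. trunc a $ i) + t * (\<Sum>i\<in>UNIV. trunc b $ i))"
    by (simp add: exp_powr_real exp_add mult.commute)
  also have "det (principal_block K C) = exp (\<Sum>i\<in>K. c $ i - \<gamma>)"
  proof -
    have "principal_block K C = diag_matrix (\<chi> i. if i \<in> K then exp (c $ i - \<gamma>) else 1)"
      by (auto simp: principal_block_def C_def diag_matrix_def vec_eq_iff)
    then show ?thesis
      by (simp add: det_diag_matrix exp_sum flip: prod.inter_restrict)
  qed
  finally have *: "(\<Sum>i\<in>K. c $ i - \<gamma>)
      \<le> (1 - t) * (\<Sum>i\<in>UNIV. trunc a $ i) + t * (\<Sum>i\<in>UNIV. trunc b $ i)"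
    by simp
  have trunc_sum: "(\<Sum>i\<in>UNIV. trunc x $ i) = (\<Sum>i\<in>{..m}. x $ i) - card {..m} * x $ m"
    if "decreasing x" for x
  proof -
    have "trunc x $ i = (if i \<in> {..m} then x $ i - x $ m else 0)" for i
    proof (cases "i \<le> m")
      case True
      then have "x $ m \<le> x $ i"
        using that by (simp add: decreasing_def)
      with True show ?thesis
        by (simp add: trunc_def)
    next
      case False
      then have "x $ i \<le> x $ m"
        using that by (simp add: decreasing_def)
      with False show ?thesis
        by (simp add: trunc_def)
    qed
    then have "(\<Sum>i\<in>UNIV. trunc x $ i) = (\<Sum>i\<in>{..m}. x $ i - x $ m)"
      by (simp only: sum.inter_restrict[OF finite, symmetric] Int_UNIV_left)
    then show ?thesis
      by (simp add: sum_subtractf)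
  qed
  have "(\<Sum>i\<in>K. c $ i) - card {..m} * \<gamma>
      \<le> (1 - t) * ((\<Sum>i\<in>{..m}. a $ i) - card {..m} * a $ m)
        + t * ((\<Sum>i\<in>{..m}. b $ i) - card {..m} * b $ m)"
    using * by (simp only: trunc_sum[OF a] trunc_sum[OF b] sum_subtractf sum_constant K)
  then show ?thesis
    by (simp add: \<gamma>_def sum.distrib sum_subtractf algebra_simps sum_distrib_left)
qed

text \<open>Rotating by \<open>H\<close> reduces majorization to a diagonal intermediate matrix; the total sums agree since
  the determinant is log-linear along geodesics. The last conclusion says that equality in the
  majorization forces \<open>A = B\<close>: the trace is a combination of exponentials \<open>exp(t d\<^sub>k)\<close> with
  positive coefficients, so equal traces at three parameters force \<open>d = 0\<close>.\<close>

lemma geodesic_spectrum: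
  fixes A B :: "real ^ 'n::{finite,linorder} ^ 'n::{finite,linorder}"
  assumes A: "pos_def A" and B: "pos_def B" and t: "0 < t" "t < 1"
  obtains G a G' b H c where
    "orthogonal_matrix G" "A = conj_diag G (vmap exp a)"
    "orthogonal_matrix G'" "B = conj_diag G' (vmap exp b)"
    "orthogonal_matrix H" "geodesic A B t = conj_diag H (vmap exp c)"
    "majorizes ((1 - t) *\<^sub>R a + t *\<^sub>R b) c" "A \<noteq> B \<Longrightarrow> a = b \<Longrightarrow> c \<notin> rearrangements a"
proof -
  obtain G a where G: "orthogonal_matrix G" "A = conj_diag G (vmap exp a)" "decreasing a"
    using pos_def_spectral_exp_decreasing[OF A] .
  obtain G' b where G': "orthogonal_matrix G'" "B = conj_diag G' (vmap exp b)" "decreasing b"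
    using pos_def_spectral_exp_decreasing[OF B] .
  obtain L d where L: "det L \<noteq> 0" "A = conj_diag L 1" "B = conj_diag L (vmap exp d)"
      and C: "geodesic A B t = conj_diag L (vmap exp (t *\<^sub>R d))"
    using geodesic_representation[OF A B] by metis
  have "pos_def (geodesic A B t)"
    using pos_def_congruence[OF pos_def_conj_diag_exp[OF orthogonal_matrix_id] L(1)]
    by (simp add: C conj_diag_def)
  then obtain H c where H: "orthogonal_matrix H" "geodesic A B t = conj_diag H (vmap exp c)"
    using pos_def_spectral_exp by blast
  have form: "z \<bullet> (diag_matrix (vmap exp c) *v z)
      \<le> (z \<bullet> (conj_diag (transpose H ** G) (vmap exp a) *v z)) powr (1 - t)
        * (z \<bullet> (conj_diag (transpose H ** G') (vmap exp b) *v z)) powr t" for z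
  proof -
    have rotate: "z \<bullet> (conj_diag (transpose H ** U) e *v z)
        = (H *v z) \<bullet> (conj_diag U e *v (H *v z))" for U e
      by (simp add: inner_conj_diag flip: vector_matrix_mul_assoc)
    have "diag_matrix (vmap exp c) = conj_diag (transpose H ** H) (vmap exp c)"
      by (simp add: orthogonal_matrix_cancel[OF H(1)])
    then show ?thesis
      using conj_diag_form_geometric_mean[OF t, of "H *v z" L d]
      by (simp add: rotate flip: L C G(2) G'(2) H(2))
  qed
  have orth: "orthogonal_matrix (transpose H ** G)" "orthogonal_matrix (transpose H ** G')"
    using G(1) G'(1) H(1) by (simp_all add: orthogonal_matrix_mul)
  have "majorizes ((1 - t) *\<^sub>R a + t *\<^sub>R b) c"
    unfolding majorizes_def
  proof (intro conjI allI impI)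
    fix m :: 'n and K :: "'n set" assume "card K = card {..m}"
    then show "(\<Sum>i\<in>K. c $ i) \<le> (\<Sum>i\<in>{..m}. ((1 - t) *\<^sub>R a + t *\<^sub>R b) $ i)"
      by (rule log_eigenvalue_partial_sums[OF orth(1) G(3) orth(2) G'(3) t form])
  next
    have det: "det (conj_diag U (vmap exp x)) = exp (\<Sum>i\<in>UNIV. x $ i)"
      if "orthogonal_matrix U" for U x
      by (simp add: det_conj_diag det_orthogonal_power2[OF that] exp_sum)
    have l: "(det L)\<^sup>2 = exp (\<Sum>i\<in>UNIV. a $ i)"
      using L(2) G det[OF G(1), of a] by (simp add: det_conj_diag)
    have "(det L)\<^sup>2 * exp (\<Sum>i\<in>UNIV. d $ i) = exp (\<Sum>i\<in>UNIV. b $ i)"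
      using L(3) G' det[OF G'(1), of b] by (simp add: det_conj_diag exp_sum)
    then have db: "(\<Sum>i\<in>UNIV. d $ i) = (\<Sum>i\<in>UNIV. b $ i) - (\<Sum>i\<in>UNIV. a $ i)"
      by (simp add: l flip: exp_add)
    have "exp (\<Sum>i\<in>UNIV. c $ i) = (det L)\<^sup>2 * exp (t * (\<Sum>i\<in>UNIV. d $ i))"
      using C H det[OF H(1), of c] by (simp add: det_conj_diag exp_sum sum_distrib_left)
    then have "(\<Sum>i\<in>UNIV. c $ i) = (\<Sum>i\<in>UNIV. a $ i) + t * (\<Sum>i\<in>UNIV. d $ i)"
      by (simp add: l flip: exp_add)
    then show "(\<Sum>i\<in>UNIV. c $ i) = (\<Sum>i\<in>UNIV. ((1 - t) *\<^sub>R a + t *\<^sub>R b) $ i)"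
      by (simp add: db sum.distrib sum_subtractf algebra_simps sum_distrib_left)
  qed
  moreover have "c \<notin> rearrangements a" if "A \<noteq> B" "a = b"
  proof
    assume c: "c \<in> rearrangements a"
    \<comment> \<open>\<open>l k\<close> is the coefficient of \<open>exp(t d\<^sub>k)\<close> in the trace of the geodesic at parameter \<open>t\<close>.\<close>
    define l where "l k = (\<Sum>i\<in>UNIV. (L $ i $ k)\<^sup>2)" for k
    have "0 < l k" for k
    proof -
      have "\<exists>i. L $ i $ k \<noteq> 0"
      proof (rule ccontr)
        assume "\<not> (\<exists>i. L $ i $ k \<noteq> 0)"
        then have "det L = 0"
          by (intro det_zero_column(2)[of k]) (simp add: column_def vec_eq_iff)
        with L(1) show False by simp
      qed
      then show ?thesis
        unfolding l_def by (auto intro: sum_pos2)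
    qed
    define T where "T = (\<Sum>i\<in>UNIV. exp (a $ i))"
    have "(\<Sum>i\<in>UNIV. geodesic A B t $ i $ i) = T"
      using rearrangements_sum[OF c, of exp]
      by (simp add: T_def H(2) trace_orthogonal_conj_diag[OF H(1)])
    moreover have "(\<Sum>i\<in>UNIV. A $ i $ i) = T" "(\<Sum>i\<in>UNIV. B $ i $ i) = T"
      using that(2)
      by (simp_all add: T_def G(2) G'(2) trace_orthogonal_conj_diag[OF G(1)]
          trace_orthogonal_conj_diag[OF G'(1)])
    ultimately have tr: "(\<Sum>k\<in>UNIV. l k) = T" "(\<Sum>k\<in>UNIV. exp (d $ k) * l k) = T"
      "(\<Sum>k\<in>UNIV. exp (t * d $ k) * l k) = T"
      unfolding C unfolding L(2,3) by (simp_all add: trace_conj_diag l_def)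
    have "(\<Sum>k\<in>UNIV. ((1 - t) + t * exp (d $ k) - exp (t * d $ k)) * l k)
        = (1 - t) * (\<Sum>k\<in>UNIV. l k) + t * (\<Sum>k\<in>UNIV. exp (d $ k) * l k)
          - (\<Sum>k\<in>UNIV. exp (t * d $ k) * l k)"
      unfolding sum_distrib_left sum.distrib[symmetric] sum_subtractf[symmetric]
      by (intro sum.cong refl) (simp add: algebra_simps)
    also have "\<dots> = 0"
      unfolding tr by (simp add: algebra_simps)
    finally have zero: "(\<Sum>k\<in>UNIV. ((1 - t) + t * exp (d $ k) - exp (t * d $ k)) * l k) = 0" .
    have "d $ k = 0" for k
    proof (rule ccontr)
      assume "d $ k \<noteq> 0"
      have "0 \<le> ((1 - t) + t * exp (d $ j) - exp (t * d $ j)) * l j" for j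
        using exp_strict_convex_bound[OF t, of "d $ j"] \<open>0 < l j\<close> by (cases "d $ j = 0") auto
      moreover have "0 < ((1 - t) + t * exp (d $ k) - exp (t * d $ k)) * l k"
        using exp_strict_convex_bound[OF t \<open>d $ k \<noteq> 0\<close>] \<open>0 < l k\<close> by simp
      ultimately have "0 < (\<Sum>k\<in>UNIV. ((1 - t) + t * exp (d $ k) - exp (t * d $ k)) * l k)"
        by (intro sum_pos2[of UNIV k]) auto
      with zero show False by simp
    qed
    then have "vmap exp d = 1"
      by (simp add: vec_eq_iff)
    then show False
      using that(1) L(2,3) by simp
  qed
  ultimately show ?thesis
    using that G G' H by blast
qed

section \<open>Equivalence of the convexity notions\<close>

lemma convex_sym_matrices: "convex sym_matrices"
  by (auto simp: convex_def sym_matrices_def transpose_def vec_eq_iff)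

theorem theorem3p1:
  fixes F :: "real ^ 'q::{finite,linorder} ^ 'q::{finite,linorder} \<Rightarrow> real"
    and f :: "real ^ 'q::{finite,linorder} \<Rightarrow> real"
  assumes "orthogonally_invariant F"
    and "corresponding_fun F f"
  shows "(g_convex F \<longleftrightarrow> convex_in_log F) \<and>
         (convex_in_log F \<longleftrightarrow> convex_on UNIV f) \<and>
         (strictly_g_convex F \<longleftrightarrow> strictly_convex_in_log F) \<and>
         (strictly_convex_in_log F \<longleftrightarrow> strictly_convex_on UNIV f)"
proof -
  have f: "symmetric_fun f"
    using assms(2) by (simp add: corresponding_fun_def)
  have F: "F (conj_diag H (vmap exp a)) = f a" if "orthogonal_matrix H" for H a
    using corresponding_fun_conj_diag[OF assms(2) that] .
  have F_exp: "F (matrix_exp (conj_diag H a)) = f a" if "orthogonal_matrix H" for H a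
    using F[OF that] by (simp add: matrix_exp_conj_diag[OF that])
  have F_diag: "F (diag_matrix (vmap exp x)) = f x" "F (matrix_exp (diag_matrix x)) = f x" for x
    using F[OF orthogonal_matrix_id] F_exp[OF orthogonal_matrix_id] by simp_all
  have pd: "pos_def (diag_matrix (vmap exp x))" for x :: "real ^ 'q::{finite,linorder}"
    using pos_def_conj_diag_exp[OF orthogonal_matrix_id, of x] by simp
  have sym: "diag_matrix x \<in> sym_matrices" for x :: "real ^ 'q::{finite,linorder}"
    by (simp add: sym_matrices_def)
  have "convex_on UNIV f" if "g_convex F"
  proof (rule convex_onI)
    fix t :: real and x y :: "real ^ 'q::{finite,linorder}" assume t: "0 < t" "t < 1"
    then have "F (geodesic (diag_matrix (vmap exp x)) (diag_matrix (vmap exp y)) t)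
        \<le> (1 - t) * F (diag_matrix (vmap exp x)) + t * F (diag_matrix (vmap exp y))"
      using that pd by (simp add: g_convex_def)
    then show "f ((1 - t) *\<^sub>R x + t *\<^sub>R y) \<le> (1 - t) * f x + t * f y"
      by (simp add: geodesic_diag_matrix F_diag)
  qed simp
  moreover have "g_convex F" if "convex_on UNIV f"
    unfolding g_convex_def
  proof (intro allI impI)
    fix A B :: "real ^ 'q::{finite,linorder} ^ 'q::{finite,linorder}" and t :: real
    assume AB: "pos_def A" "pos_def B" and t: "0 < t" "t < 1"
    from geodesic_spectrum[OF this] obtain G a G' b H c where
      *: "orthogonal_matrix G" "A = conj_diag G (vmap exp a)"
      "orthogonal_matrix G'" "B = conj_diag G' (vmap exp b)"
      "orthogonal_matrix H" "geodesic A B t = conj_diag H (vmap exp c)"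
      "majorizes ((1 - t) *\<^sub>R a + t *\<^sub>R b) c" by metis
    then show "F (geodesic A B t) \<le> (1 - t) * F A + t * F B"
      using convex_bound_of_majorizes[OF f that *(7)] t by (simp add: *(2,4,6) F)
  qed
  moreover have "convex_on UNIV f" if "convex_in_log F"
  proof (rule convex_onI)
    fix t :: real and x y :: "real ^ 'q::{finite,linorder}" assume t: "0 < t" "t < 1"
    then have "F (matrix_exp ((1 - t) *\<^sub>R diag_matrix x + t *\<^sub>R diag_matrix y))
        \<le> (1 - t) * F (matrix_exp (diag_matrix x)) + t * F (matrix_exp (diag_matrix y))"
      using that sym by (simp add: convex_in_log_def convex_on_def)
    then show "f ((1 - t) *\<^sub>R x + t *\<^sub>R y) \<le> (1 - t) * f x + t * f y"
      by (simp add: F_diag flip: diag_matrix_add_scaleR)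
  qed simp
  moreover have "convex_in_log F" if "convex_on UNIV f"
    unfolding convex_in_log_def
  proof (rule convex_onI)
    fix t :: real and A B :: "real ^ 'q::{finite,linorder} ^ 'q::{finite,linorder}"
    assume t: "0 < t" "t < 1" and AB: "A \<in> sym_matrices" "B \<in> sym_matrices"
    have t': "0 < 1 - t" "1 - t + t = 1"
      using t by simp_all
    from linear_combination_spectrum[OF AB t'(1) t(1) t'(2)] obtain G a G' b H c where
      *: "orthogonal_matrix G" "A = conj_diag G a" "orthogonal_matrix G'" "B = conj_diag G' b"
      "orthogonal_matrix H" "(1 - t) *\<^sub>R A + t *\<^sub>R B = conj_diag H c"
      "majorizes ((1 - t) *\<^sub>R a + t *\<^sub>R b) c" by metis
    then show "F (matrix_exp ((1 - t) *\<^sub>R A + t *\<^sub>R B))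
        \<le> (1 - t) * F (matrix_exp A) + t * F (matrix_exp B)"
      unfolding *(6) using convex_bound_of_majorizes[OF f that *(7)] t by (simp add: *(2,4) F_exp)
  qed (rule convex_sym_matrices)
  moreover have "strictly_convex_on UNIV f" if "strictly_g_convex F"
    unfolding strictly_convex_on_def
  proof (intro conjI ballI allI impI)
    fix x y :: "real ^ 'q::{finite,linorder}" and u v :: real
    assume uv: "0 < u" "0 < v" "u + v = 1" and "x \<noteq> y"
    then have "F (geodesic (diag_matrix (vmap exp x)) (diag_matrix (vmap exp y)) v)
        < (1 - v) * F (diag_matrix (vmap exp x)) + v * F (diag_matrix (vmap exp y))"
      using that pd by (simp add: strictly_g_convex_def)
    moreover have "u = 1 - v"
      using uv by simp
    ultimately show "f (u *\<^sub>R x + v *\<^sub>R y) < u * f x + v * f y"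
      by (simp add: geodesic_diag_matrix F_diag)
  qed simp
  moreover have "strictly_g_convex F" if "strictly_convex_on UNIV f"
    unfolding strictly_g_convex_def
  proof (intro allI impI)
    fix A B :: "real ^ 'q::{finite,linorder} ^ 'q::{finite,linorder}" and t :: real
    assume AB: "pos_def A" "pos_def B" "A \<noteq> B" and t: "0 < t" "t < 1"
    from geodesic_spectrum[OF AB(1,2) t] AB(3) obtain G a G' b H c where
      *: "orthogonal_matrix G" "A = conj_diag G (vmap exp a)"
      "orthogonal_matrix G'" "B = conj_diag G' (vmap exp b)"
      "orthogonal_matrix H" "geodesic A B t = conj_diag H (vmap exp c)"
      "majorizes ((1 - t) *\<^sub>R a + t *\<^sub>R b) c" "a = b \<Longrightarrow> c \<notin> rearrangements a" by metis
    then show "F (geodesic A B t) < (1 - t) * F A + t * F B"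
      using strictly_convex_bound_of_majorizes[OF f that *(7)] t by (simp add: *(2,4,6) F)
  qed
  moreover have "strictly_convex_on UNIV f" if "strictly_convex_in_log F"
    unfolding strictly_convex_on_def
  proof (intro conjI ballI allI impI)
    fix x y :: "real ^ 'q::{finite,linorder}" and u v :: real
    assume "0 < u" "0 < v" "u + v = 1" "x \<noteq> y"
    then have "F (matrix_exp (u *\<^sub>R diag_matrix x + v *\<^sub>R diag_matrix y))
        < u * F (matrix_exp (diag_matrix x)) + v * F (matrix_exp (diag_matrix y))"
      using that sym by (simp add: strictly_convex_in_log_def strictly_convex_on_def)
    then show "f (u *\<^sub>R x + v *\<^sub>R y) < u * f x + v * f y"
      by (simp add: F_diag flip: diag_matrix_add_scaleR)
  qed simp
  moreover have "strictly_convex_in_log F" if "strictly_convex_on UNIV f"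
    unfolding strictly_convex_in_log_def strictly_convex_on_def
  proof (intro conjI ballI allI impI)
    fix A B :: "real ^ 'q::{finite,linorder} ^ 'q::{finite,linorder}" and u v :: real
    assume AB: "A \<in> sym_matrices" "B \<in> sym_matrices" "A \<noteq> B" and uv: "0 < u" "0 < v" "u + v = 1"
    from linear_combination_spectrum[OF AB(1,2) uv] AB(3) obtain G a G' b H c where
      *: "orthogonal_matrix G" "A = conj_diag G a" "orthogonal_matrix G'" "B = conj_diag G' b"
      "orthogonal_matrix H" "u *\<^sub>R A + v *\<^sub>R B = conj_diag H c"
      "majorizes (u *\<^sub>R a + v *\<^sub>R b) c" "a = b \<Longrightarrow> c \<notin> rearrangements a" by metis
    then show "F (matrix_exp (u *\<^sub>R A + v *\<^sub>R B)) < u * F (matrix_exp A) + v * F (matrix_exp B)"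
      unfolding *(6) using strictly_convex_bound_of_majorizes[OF f that *(7)] uv
      by (simp add: *(2,4) F_exp)
  qed (rule convex_sym_matrices)
  ultimately show ?thesis by blast
qed

end
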